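(* (i) The statement "$\mathrm{N}(k)<+\infty$ for every $k\in\mathbb{N}$" is equivalent to the statement "for every integer $k\ge 3$, $\sup\{n(F): F$ a clause-irreducible unsatisfiable hitting clause-set with $\delta(F)=k\}<+\infty$". (ii) The statement "$\mathrm{N}(k)=4k-5$ for every integer $k\ge 2$" is equivalent to the statement "for every integer $k\ge 3$, every clause-irreducible unsatisfiable hitting clause-set $F$ with $\delta(F)=k$ satisfies $n(F)\le 4k-5$".
   Context: Variables are positive integers, literals are nonzero integers, the complement of $x$ is $\overline{x}=-x$. A clause is a finite set of literals with no pair $x,\overline{x}$. A clause-set is a finite set of clauses; $\top$ is the empty clause-set. $n(F)$ is the number of variables occurring in $F$, $c(F)=|F|$, $\delta(F)=c(F)-n(F)$. $F$ is satisfiable if some clause meets every clause of $F$, otherwise unsatisfiable. $F$ is hitting if any two distinct clauses $C,D\in F$ have some $x\in C$ with $\overline{x}\in D$. $\mathrm{ldeg}_F(x)$ is the number of clauses of $F$ containing $x$; a variable $v$ of $F$ is singular if $\min(\mathrm{ldeg}_F(v),\mathrm{ldeg}_F(\overline v))=1$; $F$ is nonsingular if it has no singular variables. $\mathrm{N}(k)\in\mathbb{N}_0\cup\{+\infty\}$ is the supremum of $n(F)$ over nonsingular unsatisfiable hitting clause-sets $F$ with $\delta(F)=k$. A clause-set $F'\ne\top$ is a clause-factor if $\{D\setminus\bigcap F':D\in F'\}$ is unsatisfiable; a clause-factor of $F$ is a subset $F'\subseteq F$ which is a clause-factor; it is trivial if $c(F')=1$ or ($F'$ unsatisfiable and $F'=F$).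 $F$ is clause-irreducible if all its clause-factors are trivial. *)

theory Defs
  imports Main "HOL-Library.Extended_Nat"
begin

type_synonym literal = int
type_synonym clause = "literal set"
type_synonym clause_set = "clause set"

definition is_clause :: "clause \<Rightarrow> bool" where
  "is_clause C \<longleftrightarrow> finite C \<and> 0 \<notin> C \<and> (\<forall>x\<in>C. - x \<notin> C)"

definition is_clause_set :: "clause_set \<Rightarrow> bool" where
  "is_clause_set F \<longleftrightarrow> finite F \<and> (\<forall>C\<in>F. is_clause C)"

definition vars :: "clause_set \<Rightarrow> int set" where
  "vars F = {v. v > 0 \<and> (\<exists>C\<in>F. v \<in> C \<or> - v \<in> C)}"

definition nvars :: "clause_set \<Rightarrow> nat" where
  "nvars F = card (vars F)"

definition deficiency :: "clause_set \<Rightarrow> int" where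
  "deficiency F = int (card F) - int (nvars F)"

text \<open>The clause \<open>C\<close> acts as a partial assignment, namely the set of literals made true.\<close>

definition satisfiable :: "clause_set \<Rightarrow> bool" where
  "satisfiable F \<longleftrightarrow> (\<exists>C. is_clause C \<and> (\<forall>D\<in>F. C \<inter> D \<noteq> {}))"

definition hitting :: "clause_set \<Rightarrow> bool" where
  "hitting F \<longleftrightarrow> (\<forall>C\<in>F. \<forall>D\<in>F. C \<noteq> D \<longrightarrow> (\<exists>x\<in>C. - x \<in> D))"

definition unsat_hitting :: "clause_set \<Rightarrow> bool" where
  "unsat_hitting F \<longleftrightarrow> is_clause_set F \<and> hitting F \<and> \<not> satisfiable F"

definition ldeg :: "clause_set \<Rightarrow> literal \<Rightarrow> nat" where
  "ldeg F x = card {C \<in> F. x \<in> C}"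

definition singular_var :: "clause_set \<Rightarrow> int \<Rightarrow> bool" where
  "singular_var F v \<longleftrightarrow> v \<in> vars F \<and> min (ldeg F v) (ldeg F (- v)) = 1"

definition nonsingular :: "clause_set \<Rightarrow> bool" where
  "nonsingular F \<longleftrightarrow> (\<forall>v. \<not> singular_var F v)"

definition N :: "nat \<Rightarrow> enat" where
  "N k = (SUP F \<in> {F. unsat_hitting F \<and> nonsingular F \<and> deficiency F = int k}. enat (nvars F))"

definition is_clause_factor :: "clause_set \<Rightarrow> bool" where
  "is_clause_factor F' \<longleftrightarrow>
     is_clause_set F' \<and> F' \<noteq> {} \<and> \<not> satisfiable ((\<lambda>D. D - \<Inter> F') ` F')"

definition clause_factor_of :: "clause_set \<Rightarrow> clause_set \<Rightarrow> bool" where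
  "clause_factor_of F' F \<longleftrightarrow> F' \<subseteq> F \<and> is_clause_factor F'"

definition trivial_clause_factor_of :: "clause_set \<Rightarrow> clause_set \<Rightarrow> bool" where
  "trivial_clause_factor_of F' F \<longleftrightarrow>
     clause_factor_of F' F \<and> (card F' = 1 \<or> (\<not> satisfiable F' \<and> F' = F))"

definition clause_irreducible :: "clause_set \<Rightarrow> bool" where
  "clause_irreducible F \<longleftrightarrow>
     (\<forall>F'. clause_factor_of F' F \<longrightarrow> trivial_clause_factor_of F' F)"

end

theory Submission imports Defs begin

text \<open>
  Let \<open>L(F)\<close> be the number of literals occurring exactly once in \<open>F\<close>. The core is the inequality
  \<open>n(F) + 1 \<le> j m(j) + L(F)\<close> for unsatisfiable hitting \<open>F\<close> with a variable and deficiency \<open>j + 1\<close>,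
  where \<open>m \<ge> 4\<close> is monotone and the inequality is known for irreducible \<open>F\<close>; it is proved by
  induction on the number of clauses. Setting a once-occurring literal to true removes one variable
  and one clause, and \<open>L\<close> strictly decreases. If \<open>F\<close> is nonsingular and has a
  nontrivial clause-factor \<open>F'\<close> with core \<open>C\<close>, it splits into \<open>(F - F') \<union> {C}\<close> and
  \<open>{D - C | D \<in> F'}\<close>; if these share \<open>s\<close> variables, the deficiencies minus 1 add up to that of
  \<open>F\<close> minus \<open>s\<close>, and the values of \<open>L\<close> are at most \<open>2s + 1\<close> and \<open>2s\<close>.
  Irreducible clause-sets of deficiency at least 2 are nonsingular, and deficiency 2 forces at most
  three variables. The value \<open>4k - 5\<close> is attained by repeatedly joining
  \<open>{abc, -a-b-c, -ab, -bc, -ca}\<close> under a fresh variable.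
\<close>

section \<open>Assignments and restrictions\<close>

text \<open>\<open>T\<close> is the set of true literals of a total assignment; a clause is
  falsified when it is disjoint from \<open>T\<close>. Only nonzero literals are
  constrained.\<close>

definition assignment :: "literal set \<Rightarrow> bool" where
  "assignment T \<longleftrightarrow> (\<forall>x. x \<noteq> 0 \<longrightarrow> (- x \<in> T \<longleftrightarrow> x \<notin> T))"

definition set_true :: "literal \<Rightarrow> literal set \<Rightarrow> literal set" where
  "set_true x T = insert x (T - {- x})"

lemma assignmentD: "assignment T \<Longrightarrow> x \<noteq> 0 \<Longrightarrow> - x \<in> T \<longleftrightarrow> x \<notin> T"
  by (simp add: assignment_def)

lemma assignment_set_true: "assignment T \<Longrightarrow> x \<noteq> 0 \<Longrightarrow> assignment (set_true x T)"
  unfolding assignment_def set_true_def by (metis Diff_iff insert_iff minus_minus singletonD)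

lemma falsifying_assignment_exists:
  assumes "0 \<notin> A" "\<And>x. x \<in> A \<Longrightarrow> - x \<notin> A"
  obtains T where "assignment T" "A \<inter> T = {}"
proof
  \<comment> \<open>The literals of \<open>A\<close> become false; a variable that \<open>A\<close>
    leaves open is made true.\<close>
  let ?T = "{x. - x \<in> A \<or> (x > 0 \<and> x \<notin> A)}"
  show "assignment ?T" unfolding assignment_def
  proof (intro allI impI)
    fix x :: int assume "x \<noteq> 0"
    then show "(- x \<in> ?T) = (x \<notin> ?T)"
      using assms(2)[of x] assms(2)[of "- x"] by auto
  qed
  show "A \<inter> ?T = {}" using assms(2) by auto
qed

lemma is_clauseD:
  assumes "is_clause C"
  shows "finite C" "0 \<notin> C" "\<And>x. x \<in> C \<Longrightarrow> - x \<notin> C" "\<And>x. x \<in> C \<Longrightarrow> x \<noteq> 0" "\<And>x. - x \<in> C \<Longrightarrow> x \<notin> C"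
  using assms unfolding is_clause_def by auto

lemma is_clause_subset: "is_clause C \<Longrightarrow> D \<subseteq> C \<Longrightarrow> is_clause D"
  unfolding is_clause_def by (auto intro: finite_subset)

text \<open>This passes from finite satisfying clauses to total assignments: an assignment is cut
  down to the literals occurring in \<open>F\<close>, and conversely a clause is extended to an
  assignment by falsifying the negations of its literals.\<close>

lemma not_satisfiable_iff:
  assumes "is_clause_set F"
  shows "\<not> satisfiable F \<longleftrightarrow> (\<forall>T. assignment T \<longrightarrow> (\<exists>D\<in>F. D \<inter> T = {}))"
proof
  assume uns: "\<not> satisfiable F"
  show "\<forall>T. assignment T \<longrightarrow> (\<exists>D\<in>F. D \<inter> T = {})"
  proof (intro allI impI)
    fix T assume T: "assignment T"
    have "finite (\<Union>F)" using assms by (auto simp: is_clause_set_def is_clause_def)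
    moreover have "0 \<notin> \<Union>F" using assms by (auto simp: is_clause_set_def is_clause_def)
    ultimately have "is_clause (T \<inter> \<Union>F)"
      using assignmentD[OF T] unfolding is_clause_def by (metis IntD1 IntD2 finite_Int)
    then obtain D where "D \<in> F" "T \<inter> \<Union>F \<inter> D = {}"
      using uns unfolding satisfiable_def by blast
    then show "\<exists>D\<in>F. D \<inter> T = {}" by blast
  qed
next
  assume *: "\<forall>T. assignment T \<longrightarrow> (\<exists>D\<in>F. D \<inter> T = {})"
  show "\<not> satisfiable F"
  proof
    assume "satisfiable F"
    then obtain C where C: "is_clause C" "\<And>D. D \<in> F \<Longrightarrow> C \<inter> D \<noteq> {}"
      unfolding satisfiable_def by blast
    let ?A = "uminus ` C"
    obtain T where T: "assignment T" "?A \<inter> T = {}"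
    proof (rule falsifying_assignment_exists[of ?A])
      show "0 \<notin> ?A" using C(1) by (auto simp: is_clause_def)
      show "- x \<notin> ?A" if "x \<in> ?A" for x using that C(1) by (auto simp: is_clause_def)
    qed
    have "C \<subseteq> T"
      using T is_clauseD(4)[OF C(1)] assignmentD[OF T(1)] by blast
    then show False using * T(1) C(2) by blast
  qed
qed

lemma unsat_hitting_iff:
  "unsat_hitting F \<longleftrightarrow> is_clause_set F \<and> hitting F \<and> (\<forall>T. assignment T \<longrightarrow> (\<exists>D\<in>F. D \<inter> T = {}))"
  unfolding unsat_hitting_def using not_satisfiable_iff by blast

lemma unsat_hittingD:
  assumes "unsat_hitting F"
  shows "finite F" "\<And>C. C \<in> F \<Longrightarrow> is_clause C"
    "\<And>C D. C \<in> F \<Longrightarrow> D \<in> F \<Longrightarrow> C \<noteq> D \<Longrightarrow> \<exists>x\<in>C. - x \<in> D"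
    "\<And>T. assignment T \<Longrightarrow> \<exists>D\<in>F. D \<inter> T = {}"
  using assms unfolding unsat_hitting_iff hitting_def is_clause_set_def by auto

text \<open>Of the two literals at which distinct clauses clash, one is true. Hence every assignment
  falsifies exactly one clause of an unsatisfiable hitting clause-set; the flipping arguments below
  all rest on this.\<close>

lemma falsified_unique:
  assumes "unsat_hitting F" "C \<in> F" "D \<in> F" "assignment T" "C \<inter> T = {}" "D \<inter> T = {}"
  shows "C = D"
proof (rule ccontr)
  assume "C \<noteq> D"
  then obtain x where x: "x \<in> C" "- x \<in> D" using unsat_hittingD(3)[OF assms(1)] assms by blast
  then have "x \<noteq> 0" using unsat_hittingD(2)[OF assms(1,2)] is_clauseD(4) by blast
  then show False using assignmentD[OF assms(4)] x assms(5,6) by blast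
qed

lemma finite_vars: assumes "is_clause_set F" shows "finite (vars F)"
proof -
  have "finite (abs ` \<Union>F)" using assms by (auto simp: is_clause_set_def is_clause_def)
  moreover have "vars F \<subseteq> abs ` \<Union>F" 
  proof
    fix v assume "v \<in> vars F"
    then obtain C where "C \<in> F" "v > 0" "v \<in> C \<or> - v \<in> C" by (auto simp: vars_def)
    moreover have "v = \<bar>v\<bar>" "v = \<bar>- v\<bar>" using \<open>v > 0\<close> by auto
    ultimately show "v \<in> abs ` \<Union>F" by blast
  qed
  ultimately show ?thesis by (rule finite_subset[rotated])
qed

lemma unsat_hitting_finite_vars: "unsat_hitting F \<Longrightarrow> finite (vars F)"
  by (simp add: finite_vars unsat_hitting_def)

lemma abs_in_vars_iff:
  assumes "is_clause_set F"
  shows "\<bar>y\<bar> \<in> vars F \<longleftrightarrow> (\<exists>C\<in>F. y \<in> C \<or> - y \<in> C)"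
proof (cases "y = 0")
  case True
  then show ?thesis using assms by (auto simp: vars_def is_clause_set_def is_clause_def)
next
  case False
  then show ?thesis by (cases "y > 0") (auto simp: vars_def)
qed

text \<open>Take an assignment falsifying \<open>C\<close> and make \<open>y\<close> true. The
  clause that is falsified now was satisfied before, so it contains \<open>- y\<close>.\<close>

lemma complement_occurs:
  assumes F: "unsat_hitting F" and C: "C \<in> F" "y \<in> C"
  obtains D where "D \<in> F" "- y \<in> D"
proof -
  have cl: "is_clause C" using F C unsat_hittingD(2) by blast
  obtain T where T: "assignment T" "C \<inter> T = {}"
    using falsifying_assignment_exists[of C] is_clauseD[OF cl] by metis
  have "y \<noteq> 0" using is_clauseD(4)[OF cl] C by blast
  then have T': "assignment (set_true y T)" using T assignment_set_true by blast
  then obtain D where D: "D \<in> F" "D \<inter> set_true y T = {}" using unsat_hittingD(4)[OF F] by blast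
  have "- y \<in> D"
  proof (rule ccontr)
    assume "- y \<notin> D"
    then have "D \<inter> T = {}" using D by (auto simp: set_true_def)
    then have "D = C" using falsified_unique[OF F D(1) C(1) T(1)] T by blast
    then show False using D C by (auto simp: set_true_def)
  qed
  then show thesis using that D by blast
qed

lemma abs_in_vars_imp_occurs:
  assumes "unsat_hitting F" "\<bar>y\<bar> \<in> vars F"
  obtains D where "D \<in> F" "y \<in> D"
proof -
  obtain C where C: "C \<in> F" "y \<in> C \<or> - y \<in> C"
    using assms abs_in_vars_iff[of F y] unfolding unsat_hitting_def by blast
  show thesis
  proof (cases "y \<in> C")
    case False
    then show thesis using complement_occurs[OF assms(1) C(1), of "- y"] C that by auto
  qed (use C that in blast)
qed

lemma ldeg_pos_iff: "finite F \<Longrightarrow> 0 < ldeg F y \<longleftrightarrow> (\<exists>C\<in>F. y \<in> C)"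
  unfolding ldeg_def by (auto simp: card_gt_0_iff)

lemma ldeg_pos: "unsat_hitting F \<Longrightarrow> \<bar>y\<bar> \<in> vars F \<Longrightarrow> 0 < ldeg F y"
  by (meson abs_in_vars_imp_occurs ldeg_pos_iff unsat_hittingD(1))

lemma ldeg_pos_imp_vars: "unsat_hitting F \<Longrightarrow> 0 < ldeg F y \<Longrightarrow> \<bar>y\<bar> \<in> vars F"
  using abs_in_vars_iff[of F y] ldeg_pos_iff[of F y] by (auto simp: unsat_hitting_def is_clause_set_def)

lemma nonsingular_ldeg:
  assumes "unsat_hitting F" "nonsingular F"
  shows "ldeg F y \<noteq> 1"
proof
  assume a: "ldeg F y = 1"
  then have v: "\<bar>y\<bar> \<in> vars F" using ldeg_pos_imp_vars assms(1) by simp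
  then have "0 < ldeg F (- y)" using ldeg_pos[OF assms(1), of "- y"] by simp
  then have "min (ldeg F \<bar>y\<bar>) (ldeg F (- \<bar>y\<bar>)) = 1" using a by (cases "y \<ge> 0") auto
  then show False using v assms(2) by (auto simp: nonsingular_def singular_var_def)
qed

lemma singular_obtain_literal:
  assumes "\<not> nonsingular F"
  obtains y where "ldeg F y = 1"
proof -
  obtain v where "min (ldeg F v) (ldeg F (- v)) = 1"
    using assms unfolding nonsingular_def singular_var_def by blast
  then have "ldeg F v = 1 \<or> ldeg F (- v) = 1" by linarith
  then show thesis using that by blast
qed

text \<open>Without variables only the empty clause is available, and unsatisfiability demands at
  least one clause.\<close>

lemma nvars_eq_0_card:
  assumes "unsat_hitting F" "nvars F = 0"
  shows "card F = 1"
proof -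
  have "vars F = {}" using assms unsat_hitting_finite_vars by (simp add: nvars_def)
  then have "C = {}" if "C \<in> F" for C
    using abs_in_vars_iff[of F] assms(1) that unfolding unsat_hitting_def by blast
  moreover obtain T where "assignment T" using falsifying_assignment_exists[of "{}"] by blast
  then obtain D where "D \<in> F" using unsat_hittingD(4)[OF assms(1)] by blast
  ultimately have "F = {{}}" by auto
  then show ?thesis by simp
qed

section \<open>Setting a literal to true\<close>

definition restr :: "clause_set \<Rightarrow> literal \<Rightarrow> clause_set" where
  "restr F x = (\<lambda>C. C - {- x}) ` {C \<in> F. x \<notin> C}"

text \<open>Two distinct clauses without \<open>x\<close> clash in a variable other than that of
  \<open>x\<close>, and this clash survives the deletion of \<open>- x\<close>.\<close>

lemma restr_inj:
  assumes F: "unsat_hitting F"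
  shows "inj_on (\<lambda>C. C - {- x}) {C \<in> F. x \<notin> C}"
proof (rule inj_onI, rule ccontr)
  fix C D assume C: "C \<in> {C \<in> F. x \<notin> C}" and D: "D \<in> {C \<in> F. x \<notin> C}" and e: "C - {- x} = D - {- x}" and n: "C \<noteq> D"
  obtain z where z: "z \<in> C" "- z \<in> D" using unsat_hittingD(3)[OF F] C D n by blast
  have "z \<noteq> - x" using z D by auto
  then have "z \<in> D" using z e by blast
  then show False using z is_clauseD(3) unsat_hittingD(2)[OF F] D by blast
qed

lemma unsat_hitting_restr:
  assumes F: "unsat_hitting F" and x: "x \<noteq> 0"
  shows "unsat_hitting (restr F x)"
  unfolding unsat_hitting_iff
proof (intro conjI allI impI)
  show "is_clause_set (restr F x)"
    using unsat_hittingD(1,2)[OF F] unfolding is_clause_set_def restr_def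
    by (auto intro: is_clause_subset)
  show "hitting (restr F x)" unfolding hitting_def
  proof (intro ballI impI)
    fix C' D' assume C': "C' \<in> restr F x" and D': "D' \<in> restr F x" and ne: "C' \<noteq> D'"
    obtain C where C: "C \<in> F" "x \<notin> C" "C' = C - {- x}" using C' by (auto simp: restr_def)
    obtain D where D: "D \<in> F" "x \<notin> D" "D' = D - {- x}" using D' by (auto simp: restr_def)
    have "C \<noteq> D" using ne C D by blast
    then obtain z where z: "z \<in> C" "- z \<in> D" using unsat_hittingD(3)[OF F] C D by blast
    have "z \<noteq> - x" "- z \<noteq> - x" using z C D by auto
    then show "\<exists>z\<in>C'. - z \<in> D'" using z C D by blast
  qed
  fix T assume "assignment T"
  then have "assignment (set_true x T)" using x assignment_set_true by blast
  then obtain D where D: "D \<in> F" "D \<inter> set_true x T = {}" using unsat_hittingD(4)[OF F] by blast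
  then have "x \<notin> D" "(D - {- x}) \<inter> T = {}" by (auto simp: set_true_def)
  then show "\<exists>D\<in>restr F x. D \<inter> T = {}" using D by (auto simp: restr_def)
qed

lemma card_restr:
  assumes F: "unsat_hitting F"
  shows "card (restr F x) + ldeg F x = card F"
proof -
  have fin: "finite F" using F unsat_hittingD(1) by blast
  have "card (restr F x) = card {C \<in> F. x \<notin> C}"
    unfolding restr_def by (rule card_image[OF restr_inj[OF F]])
  moreover have "card F = card {C \<in> F. x \<notin> C} + card {C \<in> F. x \<in> C}"
    using fin by (subst card_Un_disjoint[symmetric]) (auto intro: arg_cong[where f=card])
  ultimately show ?thesis by (simp add: ldeg_def)
qed

lemma ldeg_restr:
  assumes F: "unsat_hitting F" and y: "y \<noteq> - x"
  shows "ldeg (restr F x) y = card {C \<in> F. x \<notin> C \<and> y \<in> C}"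
proof -
  have "{C \<in> restr F x. y \<in> C} = (\<lambda>C. C - {- x}) ` {C \<in> F. x \<notin> C \<and> y \<in> C}"
    using y by (auto simp: restr_def)
  moreover have "inj_on (\<lambda>C. C - {- x}) {C \<in> F. x \<notin> C \<and> y \<in> C}"
    using restr_inj[OF F, of x] by (rule inj_on_subset) auto
  ultimately show ?thesis unfolding ldeg_def by (simp add: card_image)
qed

lemma ldeg_restr_self: "ldeg (restr F x) x = 0" "x \<noteq> 0 \<Longrightarrow> ldeg (restr F x) (- x) = 0"
  by (auto simp: ldeg_def restr_def card_eq_0_iff)

lemma vars_restr_subset:
  shows "vars (restr F x) \<subseteq> vars F - {\<bar>x\<bar>}"
proof
  fix w assume "w \<in> vars (restr F x)"
  then obtain C where C: "C \<in> F" "x \<notin> C" "w > 0" "w \<in> C - {- x} \<or> - w \<in> C - {- x}"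
    by (auto simp: vars_def restr_def)
  then have "w \<in> vars F" by (auto simp: vars_def)
  moreover have "w \<noteq> \<bar>x\<bar>" using C by (cases "x \<ge> 0") auto
  ultimately show "w \<in> vars F - {\<bar>x\<bar>}" by blast
qed

lemma vars_restr_eqI:
  assumes F: "is_clause_set F"
    and lost: "\<And>w. w \<in> vars F \<Longrightarrow> w \<noteq> \<bar>x\<bar> \<Longrightarrow> \<exists>C\<in>F. x \<notin> C \<and> (w \<in> C \<or> - w \<in> C)"
  shows "vars (restr F x) = vars F - {\<bar>x\<bar>}"
proof (rule antisym[OF vars_restr_subset], rule subsetI)
  fix w assume w: "w \<in> vars F - {\<bar>x\<bar>}"
  then obtain C where C: "C \<in> F" "x \<notin> C" "w \<in> C \<or> - w \<in> C" using lost by blast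
  have "w > 0" using w by (auto simp: vars_def)
  then have "w \<noteq> - x" "- w \<noteq> - x" using w by auto
  then have "w \<in> C - {- x} \<or> - w \<in> C - {- x}" using C by blast
  moreover have "C - {- x} \<in> restr F x" using C by (auto simp: restr_def)
  ultimately have "\<exists>D\<in>restr F x. w \<in> D \<or> - w \<in> D" by (rule bexI)
  then show "w \<in> vars (restr F x)" using \<open>w > 0\<close> unfolding vars_def by simp
qed

section \<open>Literals occurring once, and deficiency\<close>

definition unit_lits :: "clause_set \<Rightarrow> literal set" where
  "unit_lits F = {y. ldeg F y = 1}"

lemma finite_unit_lits:
  assumes "unsat_hitting F" shows "finite (unit_lits F)"
proof (rule finite_subset)
  show "unit_lits F \<subseteq> \<Union>F"
  proof
    fix y assume "y \<in> unit_lits F"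
    then have "0 < ldeg F y" by (simp add: unit_lits_def)
    then show "y \<in> \<Union>F" using ldeg_pos_iff[OF unsat_hittingD(1)[OF assms]] by blast
  qed
  show "finite (\<Union>F)" using unsat_hittingD(1,2)[OF assms] is_clauseD(1) by blast
qed

lemma ldeg_eq_1_obtain:
  assumes "ldeg F y = 1"
  obtains C where "C \<in> F" "y \<in> C" "\<And>D. D \<in> F \<Longrightarrow> y \<in> D \<Longrightarrow> D = C"
proof -
  obtain C where "{C \<in> F. y \<in> C} = {C}" using assms card_1_singletonE unfolding ldeg_def by blast
  then have "C \<in> F" "y \<in> C" "\<And>D. D \<in> F \<Longrightarrow> y \<in> D \<Longrightarrow> D = C" by blast+
  then show thesis by (rule that)
qed

text \<open>If \<open>z\<close> were missing from \<open>D\<close>, some assignment would falsify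
  \<open>D\<close> and make \<open>z\<close> true. After making \<open>y\<close> false, the
  falsified clause must contain \<open>y\<close>, so it is \<open>C\<close>; but \<open>C\<close>
  contains the true literal \<open>z\<close>.\<close>

lemma ldeg_eq_1_side_clause_subset:
  assumes F: "unsat_hitting F" and y: "ldeg F y = 1" and C: "C \<in> F" "y \<in> C"
    and D: "D \<in> F" "- y \<in> D"
  shows "C - {y} \<subseteq> D"
proof
  fix z assume z: "z \<in> C - {y}"
  note clC = is_clauseD[OF unsat_hittingD(2)[OF F C(1)]]
  note clD = is_clauseD[OF unsat_hittingD(2)[OF F D(1)]]
  show "z \<in> D"
  proof (rule ccontr)
    assume nz: "z \<notin> D"
    have z0: "z \<noteq> 0" "z \<noteq> - y" and y0: "y \<noteq> 0"
      using z C(2) clC(2) clC(3)[of y] by blast+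
    obtain T where T: "assignment T" "insert (- z) D \<inter> T = {}"
    proof (rule falsifying_assignment_exists[of "insert (- z) D"])
      show "0 \<notin> insert (- z) D" using z0(1) clD(2) by auto
      show "- x \<notin> insert (- z) D" if "x \<in> insert (- z) D" for x
        using that nz clD(3)[of x] z0(1) by auto
    qed
    have T': "assignment (set_true (- y) T)" using assignment_set_true[OF T(1)] y0 by simp
    obtain E where E: "E \<in> F" "E \<inter> set_true (- y) T = {}" using unsat_hittingD(4)[OF F T'] by blast
    have "y \<in> E"
    proof (rule ccontr)
      assume "y \<notin> E"
      then have "E \<inter> T = {}" using E by (auto simp: set_true_def)
      then have "E = D" using falsified_unique[OF F E(1) D(1) T(1)] T by blast
      then show False using E D by (auto simp: set_true_def)
    qed
    then have "E = C" using ldeg_eq_1_obtain[OF y] E C by metis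
    moreover have "z \<in> T" using assignmentD[OF T(1) z0(1)] T(2) by blast
    ultimately show False using E z z0 by (auto simp: set_true_def)
  qed
qed

text \<open>By the previous lemma the second literal would occur again in every clause containing
  \<open>- y\<close>.\<close>

lemma unit_lits_same_clause_unique:
  assumes F: "unsat_hitting F" and "y \<in> unit_lits F" "z \<in> unit_lits F"
    and C: "C \<in> F" "y \<in> C" "z \<in> C"
  shows "y = z"
proof (rule ccontr)
  assume "y \<noteq> z"
  obtain D where D: "D \<in> F" "- y \<in> D" using complement_occurs[OF F C(1,2)] .
  have y: "ldeg F y = 1" and z: "ldeg F z = 1" using assms(2,3) by (auto simp: unit_lits_def)
  have "z \<in> D" using ldeg_eq_1_side_clause_subset[OF F y C(1,2) D] C \<open>y \<noteq> z\<close> by blast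
  then have "D = C" using ldeg_eq_1_obtain[OF z] D C by metis
  then show False using D C is_clauseD(3)[OF unsat_hittingD(2)[OF F C(1)]] by blast
qed

text \<open>Only one clause is dropped. It contains at most one of \<open>w\<close> and
  \<open>- w\<close>, while both occur in \<open>F\<close>, so an occurrence of the variable
  survives.\<close>

lemma vars_restr_unit:
  assumes F: "unsat_hitting F" and y: "ldeg F y = 1"
  shows "vars (restr F y) = vars F - {\<bar>y\<bar>}"
proof (rule vars_restr_eqI)
  show "is_clause_set F" using F by (simp add: unsat_hitting_def)
  fix w assume w: "w \<in> vars F" "w \<noteq> \<bar>y\<bar>"
  have wp: "\<bar>w\<bar> \<in> vars F" "\<bar>- w\<bar> \<in> vars F" using w by (auto simp: vars_def)
  obtain C where C: "C \<in> F" "y \<in> C" "\<And>D. D \<in> F \<Longrightarrow> y \<in> D \<Longrightarrow> D = C"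
    using ldeg_eq_1_obtain[OF y] by metis
  obtain D1 where D1: "D1 \<in> F" "w \<in> D1" using abs_in_vars_imp_occurs[OF F wp(1)] .
  obtain D2 where D2: "D2 \<in> F" "- w \<in> D2" using abs_in_vars_imp_occurs[OF F wp(2)] .
  have "\<not> (w \<in> C \<and> - w \<in> C)" using is_clauseD(3)[OF unsat_hittingD(2)[OF F C(1)]] by blast
  then show "\<exists>C\<in>F. y \<notin> C \<and> (w \<in> C \<or> - w \<in> C)" using C D1 D2 by blast
qed

lemma unit_literal_nonzero: "unsat_hitting F \<Longrightarrow> ldeg F y = 1 \<Longrightarrow> y \<noteq> 0"
  by (metis ldeg_eq_1_obtain is_clauseD(2) unsat_hittingD(2))

lemma nvars_restr:
  assumes "unsat_hitting F" "vars (restr F y) = vars F - {\<bar>y\<bar>}" "\<bar>y\<bar> \<in> vars F"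
  shows "Suc (nvars (restr F y)) = nvars F"
  using assms unsat_hitting_finite_vars[OF assms(1)] unfolding nvars_def
  by (simp only: card_Suc_Diff1)

lemma deficiency_restr:
  assumes "unsat_hitting F" "vars (restr F y) = vars F - {\<bar>y\<bar>}" "\<bar>y\<bar> \<in> vars F"
  shows "deficiency F = deficiency (restr F y) + int (ldeg F y) - 1"
  using nvars_restr[OF assms] card_restr[OF assms(1), of y] unfolding deficiency_def by linarith

text \<open>Only the literals of the unique clause through \<open>y\<close> lose an occurrence. Such a literal can
  become a unit literal only if \<open>- y\<close> is one as well, and then at most one does.\<close>

lemma card_unit_lits_restr:
  assumes F: "unsat_hitting F" and y: "ldeg F y = 1"
  shows "card (unit_lits (restr F y)) < card (unit_lits F)"
proof -
  let ?R = "restr F y"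
  have y0: "y \<noteq> 0" using unit_literal_nonzero[OF F y] .
  have R: "unsat_hitting ?R" using unsat_hitting_restr[OF F y0] .
  have fin: "finite F" using unsat_hittingD(1)[OF F] .
  obtain C where C: "C \<in> F" "y \<in> C" "\<And>D. D \<in> F \<Longrightarrow> y \<in> D \<Longrightarrow> D = C"
    using ldeg_eq_1_obtain[OF y] by metis
  obtain D where D: "D \<in> F" "- y \<in> D" using complement_occurs[OF F C(1,2)] .
  have yD: "y \<notin> D" using is_clauseD(5)[OF unsat_hittingD(2)[OF F D(1)] D(2)] .
  have finU: "finite (unit_lits F)" using finite_unit_lits[OF F] .
  have yU: "y \<in> unit_lits F" using y by (simp add: unit_lits_def)
  have ny: "z \<noteq> y" "z \<noteq> - y" if "z \<in> unit_lits ?R" for z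
    using that ldeg_restr_self(1)[of F y] ldeg_restr_self(2)[OF y0, of F]
    by (auto simp: unit_lits_def)
  have out: "z \<in> unit_lits F" if z: "z \<in> unit_lits ?R" "z \<notin> C" for z
  proof -
    have "{E \<in> F. y \<notin> E \<and> z \<in> E} = {E \<in> F. z \<in> E}" using C z by blast
    then show ?thesis using z ldeg_restr[OF F ny(2)[OF z(1)]] by (simp add: unit_lits_def ldeg_def)
  qed
  \<comment> \<open>All clauses containing \<open>- y\<close> contain \<open>z\<close> as well and
    remain in the restriction. As \<open>z\<close> occurs only once there, \<open>- y\<close> has
    degree 1 in \<open>F\<close>.\<close>
  have new: "- y \<in> unit_lits F \<and> z \<in> D - {- y}" if z: "z \<in> unit_lits ?R" "z \<in> C" for z
  proof -
    have sub: "{E \<in> F. - y \<in> E} \<subseteq> {E \<in> F. y \<notin> E \<and> z \<in> E}"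
      using ldeg_eq_1_side_clause_subset[OF F y C(1,2)] z ny[OF z(1)]
        is_clauseD(5)[OF unsat_hittingD(2)[OF F]] by blast
    have "card {E \<in> F. y \<notin> E \<and> z \<in> E} = 1"
      using z ldeg_restr[OF F ny(2)[OF z(1)]] by (simp add: unit_lits_def)
    then have "ldeg F (- y) \<le> 1" unfolding ldeg_def using card_mono[OF _ sub] fin by simp
    moreover have "0 < ldeg F (- y)" using ldeg_pos_iff[OF fin] D by blast
    ultimately show ?thesis using sub D ny[OF z(1)] by (auto simp: unit_lits_def)
  qed
  show ?thesis
  proof (cases "\<exists>z \<in> unit_lits ?R. z \<in> C")
    case False
    then have "unit_lits ?R \<subseteq> unit_lits F - {y}" using out ny by blast
    then have "card (unit_lits ?R) \<le> card (unit_lits F - {y})" using finU card_mono by blast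
    then show ?thesis using yU finU by (metis card_Diff1_less le_less_trans)
  next
    case True
    then obtain z where z: "z \<in> unit_lits ?R" "z \<in> C" by blast
    \<comment> \<open>This clause contains every new unit literal, and two unit literals never share
      a clause. So at most one is gained, while \<open>y\<close> and \<open>- y\<close> are
      lost.\<close>
    have D': "D - {- y} \<in> ?R" using D yD by (auto simp: restr_def)
    have "x = z" if "x \<in> unit_lits ?R" "x \<in> C" for x
      using unit_lits_same_clause_unique[OF R that(1) z(1) D'] new that z by blast
    then have "unit_lits ?R \<subseteq> insert z (unit_lits F - {y, - y})" using out ny by blast
    then have "card (unit_lits ?R) \<le> card (insert z (unit_lits F - {y, - y}))"
      using finU by (intro card_mono) auto
    also have "\<dots> \<le> Suc (card (unit_lits F - {y, - y}))" by (rule card_insert_le_m1) auto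
    also have "card (unit_lits F - {y, - y}) = card (unit_lits F) - card {y, - y}"
      using new[OF z] yU by (intro card_Diff_subset) auto
    also have "card {y, - y} = 2" using y0 by auto
    finally have "card (unit_lits ?R) \<le> Suc (card (unit_lits F) - 2)" .
    moreover have "card {y, - y} \<le> card (unit_lits F)"
      using new[OF z] yU finU by (intro card_mono) auto
    ultimately show ?thesis using \<open>card {y, - y} = 2\<close> by linarith
  qed
qed

section \<open>Variables of minimal degree and lower bounds on the deficiency\<close>

lemma min_degree_variable:
  assumes F: "unsat_hitting F" and n: "nvars F \<noteq> 0"
  obtains v where "v \<in> vars F" "vars (restr F v) = vars F - {v}" "vars (restr F (- v)) = vars F - {v}"
proof -
  have fin: "finite F" using unsat_hittingD(1)[OF F] .
  define d where "d w = card {C \<in> F. w \<in> C \<or> - w \<in> C}" for w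
  have ne: "vars F \<noteq> {}" using n by (auto simp: nvars_def)
  define v where "v = arg_min_on d (vars F)"
  have v: "v \<in> vars F" and vmin: "\<And>w. w \<in> vars F \<Longrightarrow> d v \<le> d w"
    using arg_min_if_finite[OF unsat_hitting_finite_vars[OF F] ne, of d] unfolding v_def
    by (auto simp: not_less)
  have vp: "v > 0" using v by (auto simp: vars_def)
  have "vars (restr F x) = vars F - {\<bar>x\<bar>}" if x: "\<bar>x\<bar> = v" for x
  proof (rule vars_restr_eqI)
    show "is_clause_set F" using F by (simp add: unsat_hitting_def)
    fix w assume w: "w \<in> vars F" "w \<noteq> \<bar>x\<bar>"
    show "\<exists>C\<in>F. x \<notin> C \<and> (w \<in> C \<or> - w \<in> C)"
    proof (rule ccontr)
      assume "\<not> ?thesis"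
      \<comment> \<open>A variable lost together with the clauses containing \<open>x\<close> would
        occur in fewer clauses than \<open>v\<close>, because \<open>- x\<close> occurs in further
        ones.\<close>
      then have sub: "{C \<in> F. w \<in> C \<or> - w \<in> C} \<subseteq> {C \<in> F. x \<in> C}" by blast
      have "\<bar>- x\<bar> \<in> vars F" using x v by simp
      then obtain D where D: "D \<in> F" "- x \<in> D" using abs_in_vars_imp_occurs[OF F] by blast
      then have "x \<notin> D" using is_clauseD(5) unsat_hittingD(2)[OF F] by blast
      then have "{C \<in> F. x \<in> C} \<subset> {C \<in> F. v \<in> C \<or> - v \<in> C}" using D x by (cases "x \<ge> 0") auto
      then have "{C \<in> F. w \<in> C \<or> - w \<in> C} \<subset> {C \<in> F. v \<in> C \<or> - v \<in> C}" using sub by blast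
      then have "d w < d v" unfolding d_def using fin by (intro psubset_card_mono) auto
      then show False using vmin[OF w(1)] by simp
    qed
  qed
  from this[of v] this[of "- v"] show thesis using that v vp by simp
qed

text \<open>Setting a variable of minimal degree to true removes exactly one variable and at least
  one clause, so the deficiency does not increase; the induction ends at a single clause without
  variables.\<close>

lemma deficiency_ge_1: "unsat_hitting F \<Longrightarrow> deficiency F \<ge> 1"
proof (induction "nvars F" arbitrary: F)
  case 0
  then show ?case using nvars_eq_0_card by (simp add: deficiency_def)
next
  case (Suc n)
  obtain v where v: "v \<in> vars F" "vars (restr F v) = vars F - {v}"
    using min_degree_variable[OF Suc.prems] Suc.hyps(2) by (metis Zero_not_Suc)
  have vp: "v > 0" using v by (auto simp: vars_def)
  have *: "vars (restr F v) = vars F - {\<bar>v\<bar>}" "\<bar>v\<bar> \<in> vars F" using v vp by auto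
  have "deficiency (restr F v) \<ge> 1"
    using Suc.hyps nvars_restr[OF Suc.prems *] unsat_hitting_restr[OF Suc.prems] vp by simp
  then show ?case using deficiency_restr[OF Suc.prems *] ldeg_pos[OF Suc.prems *(2)] by linarith
qed

text \<open>The degree bounds hold because both restrictions still have deficiency at least
  1.\<close>

lemma min_degree_variable_deficiency:
  assumes F: "unsat_hitting F" and n: "nvars F \<noteq> 0"
  obtains v where "v \<in> vars F" "Suc (nvars (restr F (- v))) = nvars F"
    "deficiency F = deficiency (restr F (- v)) + int (ldeg F (- v)) - 1"
    "int (ldeg F v) \<le> deficiency F" "int (ldeg F (- v)) \<le> deficiency F"
proof -
  obtain v where v: "v \<in> vars F" "vars (restr F v) = vars F - {v}" "vars (restr F (- v)) = vars F - {v}"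
    using min_degree_variable[OF F n] .
  have vp: "v > 0" using v by (auto simp: vars_def)
  have 1: "vars (restr F v) = vars F - {\<bar>v\<bar>}" "\<bar>v\<bar> \<in> vars F"
    and 2: "vars (restr F (- v)) = vars F - {\<bar>- v\<bar>}" "\<bar>- v\<bar> \<in> vars F" using v vp by auto
  have "unsat_hitting (restr F v)" "unsat_hitting (restr F (- v))"
    using unsat_hitting_restr[OF F] vp by auto
  then have "deficiency (restr F v) \<ge> 1" "deficiency (restr F (- v)) \<ge> 1"
    using deficiency_ge_1 by auto
  then show thesis
    using that[OF v(1)] nvars_restr[OF F 2] deficiency_restr[OF F 1] deficiency_restr[OF F 2] by simp
qed

lemma deficiency_1_unit_variable:
  assumes F: "unsat_hitting F" and n: "nvars F \<noteq> 0" and d: "deficiency F = 1"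
  obtains v where "v \<in> vars F" "ldeg F v = 1" "ldeg F (- v) = 1"
proof -
  obtain v where v: "v \<in> vars F" "int (ldeg F v) \<le> deficiency F" "int (ldeg F (- v)) \<le> deficiency F"
    using min_degree_variable_deficiency[OF F n] by metis
  have "\<bar>v\<bar> \<in> vars F" "\<bar>- v\<bar> \<in> vars F" using v by (auto simp: vars_def)
  then have "0 < ldeg F v" "0 < ldeg F (- v)" using ldeg_pos[OF F] by auto
  then show thesis using that v d by simp
qed

text \<open>Deficiency 1 provides a variable whose two literals both occur once. Setting it keeps
  the deficiency and lowers both sides, the right one by at least 1. If no other variable exists,
  its two literals already suffice.\<close>

lemma nvars_less_unit_lits:
  assumes "unsat_hitting F" "deficiency F = 1" "nvars F \<noteq> 0"
  shows "nvars F < card (unit_lits F)"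
  using assms
proof (induction "nvars F" arbitrary: F)
  case (Suc n)
  obtain v where v: "v \<in> vars F" "ldeg F v = 1" "ldeg F (- v) = 1"
    using deficiency_1_unit_variable[OF Suc.prems(1,3,2)] .
  have v0: "v \<noteq> 0" and va: "\<bar>v\<bar> \<in> vars F" using v by (auto simp: vars_def)
  have vs: "vars (restr F v) = vars F - {\<bar>v\<bar>}" using vars_restr_unit[OF Suc.prems(1) v(2)] .
  have n: "Suc (nvars (restr F v)) = nvars F" using nvars_restr[OF Suc.prems(1) vs va] .
  show ?case
  proof (cases "n = 0")
    case True
    have "card {v, - v} \<le> card (unit_lits F)"
      using v finite_unit_lits[OF Suc.prems(1)] by (intro card_mono) (auto simp: unit_lits_def)
    then show ?thesis using v0 True Suc.hyps by simp
  next
    case False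
    have "nvars (restr F v) < card (unit_lits (restr F v))"
      using False n Suc.hyps unsat_hitting_restr[OF Suc.prems(1) v0]
        deficiency_restr[OF Suc.prems(1) vs va] v(2) Suc.prems(2) by simp
    then show ?thesis using card_unit_lits_restr[OF Suc.prems(1) v(2)] n by linarith
  qed
qed simp

section \<open>Clause-factors\<close>

definition factor_residue :: "clause_set \<Rightarrow> clause_set" where
  "factor_residue F' = (\<lambda>D. D - \<Inter>F') ` F'"

definition factor_quotient :: "clause_set \<Rightarrow> clause_set \<Rightarrow> clause_set" where
  "factor_quotient F F' = insert (\<Inter>F') (F - F')"

locale factorisation =
  fixes F F' :: clause_set
  assumes F: "unsat_hitting F" and factor: "clause_factor_of F' F"
begin

abbreviation "core \<equiv> \<Inter>F'"
abbreviation "res \<equiv> factor_residue F'"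
abbreviation "quot \<equiv> factor_quotient F F'"

lemma sub: "F' \<subseteq> F" and ne: "F' \<noteq> {}"
  using factor by (auto simp: clause_factor_of_def is_clause_factor_def)

lemma clause: "C \<in> F \<Longrightarrow> is_clause C" using unsat_hittingD(2)[OF F] .

lemma is_clause_core: "is_clause core"
  using ne sub clause by (meson Inter_lower ex_in_conv is_clause_subset subsetD)

lemma inj_res: "inj_on (\<lambda>D. D - core) F'"
  by (rule inj_onI) blast

lemma is_clause_set_res: "is_clause_set res"
proof -
  have "finite F'" using sub unsat_hittingD(1)[OF F] finite_subset by blast
  then show ?thesis using sub clause unfolding is_clause_set_def factor_residue_def
    by (auto intro: is_clause_subset)
qed

lemma res_falsified:
  assumes "assignment T" obtains D where "D \<in> F'" "(D - core) \<inter> T = {}"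
proof -
  have "\<not> satisfiable res" using factor by (simp add: clause_factor_of_def is_clause_factor_def factor_residue_def)
  then obtain E where "E \<in> res" "E \<inter> T = {}" using not_satisfiable_iff[OF is_clause_set_res] assms by blast
  then show thesis using that by (auto simp: factor_residue_def)
qed

lemma unsat_hitting_res: "unsat_hitting res"
  unfolding unsat_hitting_iff
proof (intro conjI allI impI)
  show "is_clause_set res" by (rule is_clause_set_res)
  show "hitting res" unfolding hitting_def
  proof (intro ballI impI)
    fix C' D' assume C': "C' \<in> res" and D': "D' \<in> res" and n: "C' \<noteq> D'"
    obtain C where C: "C \<in> F'" "C' = C - core" using C' by (auto simp: factor_residue_def)
    obtain D where D: "D \<in> F'" "D' = D - core" using D' by (auto simp: factor_residue_def)
    have "C \<noteq> D" using C D n by blast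
    then obtain x where x: "x \<in> C" "- x \<in> D" using unsat_hittingD(3)[OF F] C D sub by blast
    have "x \<notin> core" using x D is_clauseD(5)[OF clause x(2)] sub by blast
    moreover have "- x \<notin> core" using x C is_clauseD(3)[OF clause x(1)] sub by blast
    ultimately show "\<exists>x\<in>C'. - x \<in> D'" using x C D by blast
  qed
  show "\<exists>D\<in>res. D \<inter> T = {}" if "assignment T" for T
    using res_falsified[OF that] by (metis factor_residue_def image_eqI)
qed

text \<open>Otherwise some assignment falsifies both \<open>core\<close> and \<open>E\<close>. The
  unsatisfiable residue then yields a clause of \<open>F'\<close> falsified together with
  \<open>E\<close>, against uniqueness of the falsified clause.\<close>

lemma core_clashes:
  assumes E: "E \<in> F - F'" obtains x where "x \<in> core" "- x \<in> E"
proof (rule ccontr)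
  assume "\<not> thesis"
  then have no: "\<And>x. x \<in> core \<Longrightarrow> - x \<notin> E" using that by blast
  note clE = is_clauseD[OF clause[of E]] and clC = is_clauseD[OF is_clause_core]
  have "E \<in> F" using E by blast
  obtain T where T: "assignment T" "(core \<union> E) \<inter> T = {}"
  proof (rule falsifying_assignment_exists[of "core \<union> E"])
    show "0 \<notin> core \<union> E" using clE(2) clC(2) \<open>E \<in> F\<close> by blast
    fix x assume "x \<in> core \<union> E"
    then show "- x \<notin> core \<union> E"
      using clE(3)[OF \<open>E \<in> F\<close>] clC(3) no no[of "- x"] by (metis Un_iff minus_minus)
  qed
  obtain D where D: "D \<in> F'" "(D - core) \<inter> T = {}" using res_falsified[OF T(1)] .
  then have "D \<inter> T = {}" using T by blast
  then have "D = E" using falsified_unique[OF F _ \<open>E \<in> F\<close> T(1)] D sub T by blast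
  then show False using D E by blast
qed

lemma core_notin: "core \<notin> F - F'"
  using core_clashes is_clauseD(3)[OF is_clause_core] by metis

text \<open>New clashes come from \<open>core_clashes\<close>. If the falsified clause of
  \<open>F\<close> lies in \<open>F'\<close>, then its subset \<open>core\<close> is falsified
  too.\<close>

lemma unsat_hitting_quot: "unsat_hitting quot"
  unfolding unsat_hitting_iff
proof (intro conjI allI impI)
  show "is_clause_set quot" using unsat_hittingD(1)[OF F] clause is_clause_core
    by (auto simp: is_clause_set_def factor_quotient_def)
  show "hitting quot" unfolding hitting_def
  proof (intro ballI impI)
    fix C D assume C: "C \<in> quot" and D: "D \<in> quot" and n: "C \<noteq> D"
    consider "C = core" "D \<in> F - F'" | "D = core" "C \<in> F - F'" | "C \<in> F" "D \<in> F"
      using C D n by (auto simp: factor_quotient_def)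
    then show "\<exists>x\<in>C. - x \<in> D"
    proof cases
      case 1
      then show ?thesis using core_clashes by metis
    next
      case 2
      then show ?thesis using core_clashes by (metis minus_minus)
    next
      case 3
      then show ?thesis using unsat_hittingD(3)[OF F] n by blast
    qed
  qed
  fix T assume "assignment T"
  then obtain D where D: "D \<in> F" "D \<inter> T = {}" using unsat_hittingD(4)[OF F] by blast
  show "\<exists>D\<in>quot. D \<inter> T = {}"
  proof (cases "D \<in> F'")
    case True
    then have "core \<inter> T = {}" using \<open>D \<inter> T = {}\<close> by blast
    then show ?thesis by (simp add: factor_quotient_def)
  next
    case False
    then show ?thesis using \<open>D \<in> F\<close> \<open>D \<inter> T = {}\<close> by (auto simp: factor_quotient_def)
  qed
qed

text \<open>The extra 1 is the clause \<open>core\<close>, which is not among the remaining clauses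
  by \<open>core_notin\<close>.\<close>

lemma card_eq: "card F + 1 = card quot + card res"
proof -
  have fin: "finite F" using unsat_hittingD(1)[OF F] .
  then have "finite F'" using sub finite_subset by blast
  have "card quot = Suc (card (F - F'))" unfolding factor_quotient_def using fin core_notin by simp
  moreover have "card res = card F'" unfolding factor_residue_def by (rule card_image[OF inj_res])
  moreover have "card (F - F') = card F - card F'" using sub \<open>finite F'\<close> by (rule card_Diff_subset[rotated])
  moreover have "card F' \<le> card F" using sub fin card_mono by blast
  ultimately show ?thesis by simp
qed

lemma vars_eq: "vars F = vars quot \<union> vars res"
proof (rule set_eqI)
  fix v
  have occ: "(\<exists>C\<in>F. y \<in> C) \<longleftrightarrow> (\<exists>C\<in>quot. y \<in> C) \<or> (\<exists>C\<in>res. y \<in> C)" for y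
  proof -
    have "(\<exists>C\<in>F. y \<in> C) \<longleftrightarrow> (\<exists>C\<in>F - F'. y \<in> C) \<or> (\<exists>C\<in>F'. y \<in> C)" using sub by blast
    moreover have "(\<exists>C\<in>F'. y \<in> C) \<longleftrightarrow> y \<in> core \<or> (\<exists>C\<in>F'. y \<in> C - core)" using ne by blast
    moreover have "(\<exists>C\<in>quot. y \<in> C) \<longleftrightarrow> y \<in> core \<or> (\<exists>C\<in>F - F'. y \<in> C)"
      unfolding factor_quotient_def by (rule bex_simps)
    moreover have "(\<exists>C\<in>res. y \<in> C) \<longleftrightarrow> (\<exists>C\<in>F'. y \<in> C - core)"
      unfolding factor_residue_def by (rule bex_simps)
    ultimately show ?thesis by argo
  qed
  have vars: "v \<in> vars H \<longleftrightarrow> v > 0 \<and> ((\<exists>C\<in>H. v \<in> C) \<or> (\<exists>C\<in>H. - v \<in> C))" for H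
    unfolding vars_def by auto
  show "v \<in> vars F \<longleftrightarrow> v \<in> vars quot \<union> vars res"
    unfolding Un_iff vars using occ[of v] occ[of "- v"] by argo
qed

definition shared :: nat where "shared = card (vars quot \<inter> vars res)"

lemma nvars_eq: "nvars F + shared = nvars quot + nvars res"
  unfolding nvars_def vars_eq shared_def
  using card_Un_Int[OF unsat_hitting_finite_vars[OF unsat_hitting_quot] unsat_hitting_finite_vars[OF unsat_hitting_res]]
  by simp

lemma deficiency_eq: "deficiency F + 1 = deficiency quot + deficiency res + int shared"
  using card_eq nvars_eq unfolding deficiency_def by linarith

lemma literals_over_shared:
  "finite {y. \<bar>y\<bar> \<in> vars quot \<inter> vars res}" "card {y. \<bar>y\<bar> \<in> vars quot \<inter> vars res} \<le> 2 * shared"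
proof -
  let ?S = "vars quot \<inter> vars res"
  have S: "finite ?S" using unsat_hitting_finite_vars[OF unsat_hitting_quot] by blast
  have sub: "{y. \<bar>y\<bar> \<in> ?S} \<subseteq> ?S \<union> uminus ` ?S"
  proof
    fix y assume "y \<in> {y. \<bar>y\<bar> \<in> ?S}"
    then show "y \<in> ?S \<union> uminus ` ?S" by (cases "y \<ge> 0") (auto simp: image_iff intro!: bexI[of _ "- y"])
  qed
  show "finite {y. \<bar>y\<bar> \<in> ?S}" using sub S finite_subset by (metis finite_Un finite_imageI)
  have "card {y. \<bar>y\<bar> \<in> ?S} \<le> card (?S \<union> uminus ` ?S)" using sub S by (intro card_mono) auto
  also have "\<dots> \<le> card ?S + card (uminus ` ?S)" by (rule card_Un_le)
  also have "\<dots> \<le> 2 * shared" using card_image_le[OF S, of uminus] by (simp add: shared_def)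
  finally show "card {y. \<bar>y\<bar> \<in> ?S} \<le> 2 * shared" .
qed

text \<open>A literal whose variable is absent from \<open>quot\<close> has the same degree in
  \<open>res\<close> as in \<open>F\<close>, and this is not 1. So unit literals of
  \<open>res\<close> lie over shared variables, two literals for each.\<close>

lemma card_unit_lits_res:
  assumes "nonsingular F"
  shows "card (unit_lits res) \<le> 2 * shared"
proof -
  have "unit_lits res \<subseteq> {y. \<bar>y\<bar> \<in> vars quot \<inter> vars res}"
  proof
    fix y assume "y \<in> unit_lits res"
    then have y: "ldeg res y = 1" by (simp add: unit_lits_def)
    then have yr: "\<bar>y\<bar> \<in> vars res" using ldeg_pos_imp_vars[OF unsat_hitting_res] by simp
    have "\<bar>y\<bar> \<in> vars quot"
    proof (rule ccontr)
      assume "\<bar>y\<bar> \<notin> vars quot"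
      then have no: "y \<notin> C" if "C \<in> quot" for C
        using that abs_in_vars_iff[of quot y] unsat_hitting_quot by (auto simp: unsat_hitting_def)
      have "{C \<in> res. y \<in> C} = (\<lambda>D. D - core) ` {C \<in> F. y \<in> C}"
        using no sub by (auto simp: factor_quotient_def factor_residue_def)
      moreover have "{C \<in> F. y \<in> C} \<subseteq> F'" using no by (auto simp: factor_quotient_def)
      ultimately have "ldeg res y = ldeg F y"
        unfolding ldeg_def by (simp add: card_image inj_on_subset[OF inj_res])
      then show False using y nonsingular_ldeg[OF F assms] by metis
    qed
    then show "y \<in> {y. \<bar>y\<bar> \<in> vars quot \<inter> vars res}" using yr by blast
  qed
  then show ?thesis using literals_over_shared card_mono le_trans by blast
qed

text \<open>As for \<open>res\<close>, except that a literal of \<open>core\<close> may drop to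
  degree 1 because all clauses of \<open>F'\<close> collapse into one. Since \<open>core\<close> is
  a single clause, it holds at most one unit literal.\<close>

lemma card_unit_lits_quot:
  assumes "nonsingular F"
  shows "card (unit_lits quot) \<le> 2 * shared + 1"
proof -
  let ?S = "{y. \<bar>y\<bar> \<in> vars quot \<inter> vars res}"
  have *: "y \<in> ?S \<or> y \<in> core" if "y \<in> unit_lits quot" for y
  proof (rule ccontr)
    assume n: "\<not> ?thesis"
    have y: "ldeg quot y = 1" using that by (simp add: unit_lits_def)
    then have "\<bar>y\<bar> \<in> vars quot" using ldeg_pos_imp_vars[OF unsat_hitting_quot] by simp
    then have "\<bar>y\<bar> \<notin> vars res" using n by blast
    then have "y \<notin> E" if "E \<in> res" for E
      using that abs_in_vars_iff[OF is_clause_set_res, of y] by blast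
    then have "y \<notin> D - core" if "D \<in> F'" for D
      using that unfolding factor_residue_def by blast
    then have "y \<notin> D" if "D \<in> F'" for D using that n by blast
    moreover have "y \<notin> core" using n by blast
    ultimately have "{C \<in> quot. y \<in> C} = {C \<in> F. y \<in> C}"
      unfolding factor_quotient_def using sub by blast
    then show False using y nonsingular_ldeg[OF F assms, of y] by (simp add: ldeg_def)
  qed
  have "core \<in> quot" by (simp add: factor_quotient_def)
  then have uniq: "y = z" if "y \<in> unit_lits quot \<inter> core" "z \<in> unit_lits quot \<inter> core" for y z
    using unit_lits_same_clause_unique[OF unsat_hitting_quot] that by blast
  have "card (unit_lits quot \<inter> core) \<le> 1"
  proof (cases "unit_lits quot \<inter> core = {}")
    case False
    then obtain z where "z \<in> unit_lits quot \<inter> core" by blast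
    then have "unit_lits quot \<inter> core = {z}" using uniq by blast
    then show ?thesis by simp
  qed simp
  moreover have "unit_lits quot \<subseteq> ?S \<union> (unit_lits quot \<inter> core)" using * by blast
  then have "card (unit_lits quot) \<le> card (?S \<union> (unit_lits quot \<inter> core))"
    using literals_over_shared finite_unit_lits[OF unsat_hitting_quot] by (intro card_mono) auto
  then have "card (unit_lits quot) \<le> card ?S + card (unit_lits quot \<inter> core)"
    using card_Un_le le_trans by blast
  ultimately show ?thesis using literals_over_shared(2) by linarith
qed

text \<open>Both pieces have at least two clauses, hence variables, and fewer clauses than
  \<open>F\<close>. This is what the induction on the number of clauses requires.\<close>

lemma nontrivial:
  assumes "\<not> trivial_clause_factor_of F' F"
  shows "nvars quot \<noteq> 0" "nvars res \<noteq> 0" "card quot < card F" "card res < card F"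
proof -
  have fin: "finite F" "finite F'" using unsat_hittingD(1)[OF F] sub finite_subset by auto
  have "card F' \<noteq> 1" "F' \<noteq> F"
    using assms factor F by (auto simp: trivial_clause_factor_of_def unsat_hitting_def)
  moreover have "card F' \<noteq> 0" using fin ne by simp
  moreover have "card res = card F'" unfolding factor_residue_def by (rule card_image[OF inj_res])
  ultimately have r: "card res > 1" by linarith
  have "F' \<subset> F" using sub \<open>F' \<noteq> F\<close> by blast
  then have "card F' < card F" using fin psubset_card_mono by blast
  then show q: "card res < card F" using \<open>card res = card F'\<close> by simp
  show "card quot < card F" using card_eq r by linarith
  have "card quot > 1" using card_eq q by linarith
  then show "nvars quot \<noteq> 0" "nvars res \<noteq> 0"
    using nvars_eq_0_card[OF unsat_hitting_quot] nvars_eq_0_card[OF unsat_hitting_res] r by auto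
qed

end

section \<open>Bounding the number of variables by induction on the number of clauses\<close>

text \<open>The function \<open>j * m j\<close> with \<open>m\<close> monotone is superadditive, which matches the additivity of
  \<open>deficiency - 1\<close> under factorisation; each shared variable costs at most 3 and adds 1 to the
  deficiency.\<close>

lemma nvars_bound:
  fixes m :: "nat \<Rightarrow> nat"
  assumes mono: "mono m" and m4: "\<And>j. 4 \<le> m j"
    and irred: "\<And>F j. clause_irreducible F \<Longrightarrow> unsat_hitting F \<Longrightarrow> deficiency F = int j + 1 \<Longrightarrow> 1 \<le> j
      \<Longrightarrow> nvars F < j * m j"
    and F: "unsat_hitting F" and n: "nvars F \<noteq> 0" and d: "deficiency F = int j + 1"
  shows "nvars F < j * m j + card (unit_lits F)"
  using F n d
proof (induction "card F" arbitrary: F j rule: less_induct)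
  case less
  note F = less.prems(1) and n = less.prems(2) and d = less.prems(3)
  show ?case
  proof (cases "deficiency F = 1")
    case True
    \<comment> \<open>Here \<open>j = 0\<close>, so the unit literals alone must outnumber the
      variables.\<close>
    then show ?thesis using nvars_less_unit_lits[OF F True n] d by simp
  next
    case False
    then have j: "1 \<le> j" using d by simp
    show ?thesis
    proof (cases "nonsingular F")
      case False
      then obtain y where y: "ldeg F y = 1" by (rule singular_obtain_literal)
      have y0: "y \<noteq> 0" using unit_literal_nonzero[OF F y] .
      have yv: "\<bar>y\<bar> \<in> vars F" using ldeg_pos_imp_vars[OF F] y by simp
      note vs = vars_restr_unit[OF F y]
      have n': "Suc (nvars (restr F y)) = nvars F" using nvars_restr[OF F vs yv] .
      \<comment> \<open>This covers a restriction without variables, to which the induction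
        hypothesis does not apply: then \<open>F\<close> has just one variable.\<close>
      have jm: "4 \<le> j * m j" using mult_le_mono[OF j m4[of j]] by simp
      show ?thesis
      proof (cases "nvars (restr F y) = 0")
        case True
        then show ?thesis using n' jm by simp
      next
        case False
        have "card (restr F y) < card F" using card_restr[OF F, of y] y by simp
        then have "nvars (restr F y) < j * m j + card (unit_lits (restr F y))"
          using less.hyps unsat_hitting_restr[OF F y0] False d deficiency_restr[OF F vs yv] y by simp
        then show ?thesis using card_unit_lits_restr[OF F y] n' by linarith
      qed
    next
      case nons: True
      show ?thesis
      proof (cases "clause_irreducible F")
        case True
        then show ?thesis using irred[OF True F d j] by simp
      next
        case False
        then obtain F' where F': "clause_factor_of F' F" "\<not> trivial_clause_factor_of F' F"
          unfolding clause_irreducible_def by blast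
        interpret factorisation F F' using F F'(1) by unfold_locales
        note nt = nontrivial[OF F'(2)]
        define a where "a = nat (deficiency quot - 1)"
        define b where "b = nat (deficiency res - 1)"
        have a: "deficiency quot = int a + 1" using deficiency_ge_1[OF unsat_hitting_quot] by (simp add: a_def)
        have b: "deficiency res = int b + 1" using deficiency_ge_1[OF unsat_hitting_res] by (simp add: b_def)
        have j_eq: "j = a + b + shared" using deficiency_eq a b d by linarith
        have "nvars quot < a * m a + card (unit_lits quot)"
          using less.hyps[OF nt(3) unsat_hitting_quot nt(1) a] .
        moreover have "nvars res < b * m b + card (unit_lits res)"
          using less.hyps[OF nt(4) unsat_hitting_res nt(2) b] .
        moreover have "a * m a \<le> a * m j" "b * m b \<le> b * m j" using mono j_eq by (auto simp: monoD)
        moreover have "shared * 4 \<le> shared * m j" using m4 by simp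
        moreover have "j * m j = a * m j + b * m j + shared * m j" unfolding j_eq by (simp add: algebra_simps)
        \<comment> \<open>The two strict inequalities leave a surplus of 2. The possible unit
          literal of \<open>core\<close> uses up 1 of it, and the other 1 makes the result
          strict.\<close>
        ultimately show ?thesis
          using nvars_eq card_unit_lits_quot[OF nons] card_unit_lits_res[OF nons] by linarith
      qed
    qed
  qed
qed

section \<open>Irreducible clause-sets\<close>

lemma clause_factorI:
  assumes "unsat_hitting F" "F' \<subseteq> F" "F' \<noteq> {}"
    and fals: "\<And>T. assignment T \<Longrightarrow> \<exists>D\<in>F'. (D - \<Inter>F') \<inter> T = {}"
  shows "clause_factor_of F' F"
proof -
  have F': "is_clause_set F'" using assms(1,2) finite_subset
    unfolding unsat_hitting_def is_clause_set_def by blast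
  have res: "is_clause_set ((\<lambda>D. D - \<Inter>F') ` F')"
    using F' unfolding is_clause_set_def by (auto intro: is_clause_subset)
  have "\<not> satisfiable ((\<lambda>D. D - \<Inter>F') ` F')"
    unfolding not_satisfiable_iff[OF res] using fals by (simp add: bex_simps)
  then show ?thesis using F' assms(2,3) unfolding clause_factor_of_def is_clause_factor_def by blast
qed

lemma irreducible_factor_cases:
  assumes "clause_irreducible F" "clause_factor_of F' F"
  shows "card F' = 1 \<or> F' = F"
  using assms unfolding clause_irreducible_def trivial_clause_factor_of_def by blast

text \<open>Making a common literal true would satisfy every clause.\<close>

lemma unsat_core_empty:
  assumes "unsat_hitting F" shows "\<Inter>F = {}"
proof (rule ccontr)
  assume "\<Inter>F \<noteq> {}"
  then obtain z where z: "\<And>D. D \<in> F \<Longrightarrow> z \<in> D" by blast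
  have z0: "z \<noteq> 0" if "D \<in> F" for D using z[OF that] is_clauseD(2)[OF unsat_hittingD(2)[OF assms that]] by auto
  obtain T0 where T0: "assignment T0" using falsifying_assignment_exists[of "{}"] by blast
  then obtain D0 where "D0 \<in> F" using unsat_hittingD(4)[OF assms] by blast
  then have "assignment (set_true z T0)" using assignment_set_true[OF T0] z0 by blast
  then obtain D where "D \<in> F" "D \<inter> set_true z T0 = {}" using unsat_hittingD(4)[OF assms] by blast
  then show False using z by (auto simp: set_true_def)
qed

text \<open>All these clauses contain \<open>C - {y}\<close>. For an assignment with
  \<open>y\<close> false the residue \<open>{y}\<close> of \<open>C\<close> is falsified; for one
  with \<open>y\<close> true a clause containing \<open>- y\<close> has to be found.\<close>

lemma unit_literal_factor:
  assumes F: "unsat_hitting F" and y: "ldeg F y = 1" and C: "C \<in> F" "y \<in> C"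
  shows "clause_factor_of (insert C {D \<in> F. - y \<in> D}) F" "\<Inter>(insert C {D \<in> F. - y \<in> D}) = C - {y}"
proof -
  let ?F' = "insert C {D \<in> F. - y \<in> D}"
  have y0: "y \<noteq> 0" using unit_literal_nonzero[OF F y] .
  have cl: "is_clause D" if "D \<in> F" for D using unsat_hittingD(2)[OF F that] .
  obtain D where D: "D \<in> F" "- y \<in> D" using complement_occurs[OF F C] .
  have yD: "y \<notin> D" using is_clauseD(5)[OF cl[OF D(1)] D(2)] .
  have side: "C - {y} \<subseteq> E" if "E \<in> F" "- y \<in> E" for E
    using ldeg_eq_1_side_clause_subset[OF F y C that] .
  show int: "\<Inter>?F' = C - {y}" using side D yD by blast
  show "clause_factor_of ?F' F"
  proof (rule clause_factorI[OF F])
    fix T assume T: "assignment T"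
    show "\<exists>D\<in>?F'. (D - \<Inter>?F') \<inter> T = {}"
    proof (cases "y \<in> T")
      case False
      then have "(C - \<Inter>?F') \<inter> T = {}" unfolding int by blast
      then show ?thesis by blast
    next
      case True
      \<comment> \<open>\<open>T'\<close> is \<open>T\<close> changed so that all literals of
        \<open>C\<close> other than \<open>y\<close> are false. A clause falsified by it contains
        \<open>- y\<close>, since otherwise making \<open>y\<close> false would falsify
        \<open>C\<close> as well as that clause.\<close>
      define T' where "T' = (T - (C - {y})) \<union> uminus ` (C - {y})"
      note clC = is_clauseD(3)[OF cl[OF C(1)]]
      have mem: "x \<in> T' \<longleftrightarrow> (x \<in> T \<and> x \<notin> C - {y}) \<or> - x \<in> C - {y}" for x
      proof -
        have "x \<in> uminus ` (C - {y}) \<longleftrightarrow> - x \<in> C - {y}" by (metis image_iff minus_minus)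
        then show ?thesis unfolding T'_def by blast
      qed
      have T': "assignment T'" unfolding assignment_def
      proof (intro allI impI)
        fix x :: int assume "x \<noteq> 0"
        then show "(- x \<in> T') = (x \<notin> T')"
          unfolding mem minus_minus using assignmentD[OF T \<open>x \<noteq> 0\<close>] clC[of x] by blast
      qed
      have yT': "y \<in> T'" unfolding mem using True by blast
      obtain E where E: "E \<in> F" "E \<inter> T' = {}" using unsat_hittingD(4)[OF F T'] by blast
      have yE: "y \<notin> E" using E yT' by blast
      have "- y \<in> E"
      proof (rule ccontr)
        assume "- y \<notin> E"
        have T'': "assignment (set_true (- y) T')" using assignment_set_true[OF T'] y0 by simp
        have "E \<inter> set_true (- y) T' = {}" using E \<open>- y \<notin> E\<close> by (auto simp: set_true_def)
        moreover have "C \<inter> set_true (- y) T' = {}"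
        proof -
          have "z \<notin> set_true (- y) T'" if "z \<in> C" for z
          proof -
            have "- z \<notin> C" using clC[OF that] .
            then have "z \<notin> T' \<or> z = y" unfolding mem using that by blast
            moreover have "z \<noteq> - y" using clC[OF C(2)] that by blast
            ultimately show ?thesis by (auto simp: set_true_def)
          qed
          then show ?thesis by blast
        qed
        ultimately have "E = C" using falsified_unique[OF F E(1) C(1) T''] by blast
        then show False using yE C by blast
      qed
      moreover have "(E - (C - {y})) \<inter> T = {}" using E mem by blast
      ultimately show ?thesis unfolding int using E(1) by blast
    qed
  qed (use C in auto)
qed

text \<open>The factor given by a unit literal \<open>y\<close> must be all of \<open>F\<close>, so
  its core is empty and \<open>C = {y}\<close>. The other clauses all contain \<open>- y\<close> and
  again form a factor, so there is only one of them. Two clauses and at least one variable leave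
  deficiency 1.\<close>

lemma irreducible_nonsingular:
  assumes irr: "clause_irreducible F" and F: "unsat_hitting F" and d: "deficiency F \<noteq> 1"
  shows "nonsingular F"
proof (rule ccontr)
  assume "\<not> nonsingular F"
  then obtain y where y: "ldeg F y = 1" by (rule singular_obtain_literal)
  have y0: "y \<noteq> 0" using unit_literal_nonzero[OF F y] .
  obtain C where C: "C \<in> F" "y \<in> C" "\<And>D. D \<in> F \<Longrightarrow> y \<in> D \<Longrightarrow> D = C"
    using ldeg_eq_1_obtain[OF y] by metis
  obtain D where D: "D \<in> F" "- y \<in> D" using complement_occurs[OF F C(1,2)] .
  have nyC: "- y \<notin> C" using C is_clauseD(3) unsat_hittingD(2)[OF F] by blast
  let ?F' = "insert C {D \<in> F. - y \<in> D}" and ?G = "{D \<in> F. - y \<in> D}"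
  note fac = unit_literal_factor[OF F y C(1,2)]
  have fin: "finite F" using unsat_hittingD(1)[OF F] .
  have CG: "C \<notin> ?G" "?G \<noteq> {}" using nyC D by auto
  have "card ?F' \<noteq> 1" using CG fin by simp
  then have F'F: "?F' = F" using irreducible_factor_cases[OF irr fac(1)] by blast
  then have "C - {y} = {}" using fac(2) unsat_core_empty[OF F] by simp
  then have Cy: "C = {y}" using C(2) by blast
  have "clause_factor_of ?G F"
  proof (rule clause_factorI[OF F])
    fix T assume "assignment T"
    then have "assignment (set_true y T)" using assignment_set_true y0 by blast
    then obtain E where E: "E \<in> F" "E \<inter> set_true y T = {}" using unsat_hittingD(4)[OF F] by blast
    then have "E \<noteq> C" using Cy by (auto simp: set_true_def)
    then have EG: "E \<in> ?G" using E F'F by blast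
    moreover have "(E - \<Inter>?G) \<inter> T = {}" using E(2) by (auto simp: set_true_def)
    ultimately show "\<exists>E\<in>?G. (E - \<Inter>?G) \<inter> T = {}" by blast
  qed (use CG in auto)
  then have "card ?G = 1" using irreducible_factor_cases[OF irr] CG C by blast
  then have "card ?F' = 2" using CG(1) fin by simp
  then have "card F = 2" unfolding F'F .
  moreover have "vars F \<noteq> {}" using ldeg_pos_imp_vars[OF F] y by fastforce
  then have "nvars F \<noteq> 0" using unsat_hitting_finite_vars[OF F] by (simp add: nvars_def)
  ultimately show False using d deficiency_ge_1[OF F] by (simp add: deficiency_def)
qed

section \<open>Full resolution pairs, and pairs of clauses covering the same assignments\<close>

definition full_resolution :: "clause \<Rightarrow> clause \<Rightarrow> bool" where
  "full_resolution A B \<longleftrightarrow> (\<exists>x Q. A = insert x Q \<and> B = insert (- x) Q \<and> x \<notin> Q \<and> - x \<notin> Q)"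

lemma full_resolution_sym: "full_resolution A B \<Longrightarrow> full_resolution B A"
proof -
  assume "full_resolution A B"
  then obtain x Q where "A = insert x Q" "B = insert (- x) Q" "x \<notin> Q" "- x \<notin> Q"
    unfolding full_resolution_def by blast
  then have "B = insert (- x) Q \<and> A = insert (- (- x)) Q \<and> - x \<notin> Q \<and> - (- x) \<notin> Q" by simp
  then show ?thesis unfolding full_resolution_def by (intro exI)
qed

lemma full_resolution_insert:
  assumes "full_resolution A B" "y \<notin> A" "y \<notin> B"
  shows "full_resolution (insert y A) (insert y B)"
proof -
  obtain x Q where *: "A = insert x Q" "B = insert (- x) Q" "x \<notin> Q" "- x \<notin> Q"
    using assms(1) unfolding full_resolution_def by blast
  then have "insert y A = insert x (insert y Q)" "insert y B = insert (- x) (insert y Q)"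
    "x \<notin> insert y Q" "- x \<notin> insert y Q" using assms(2,3) by auto
  then show ?thesis unfolding full_resolution_def by blast
qed

text \<open>Such a pair has core \<open>Q\<close> and residue consisting of \<open>{x}\<close> and
  \<open>{- x}\<close>, so it is a factor with two clauses.\<close>

lemma irreducible_no_full_resolution:
  assumes irr: "clause_irreducible F" and F: "unsat_hitting F" and c: "card F \<noteq> 2"
    and AB: "A \<in> F" "B \<in> F"
  shows "\<not> full_resolution A B"
proof
  assume "full_resolution A B"
  then obtain x Q where "A = insert x Q" "B = insert (- x) Q" and x: "x \<notin> Q" "- x \<notin> Q"
    unfolding full_resolution_def by blast
  then have in_F: "insert x Q \<in> F" "insert (- x) Q \<in> F" using AB by auto
  let ?F' = "{insert x Q, insert (- x) Q}"
  have x0: "x \<noteq> 0" using is_clauseD(2)[OF unsat_hittingD(2)[OF F in_F(1)]] by auto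
  then have ne: "x \<noteq> - x" by simp
  then have "insert x Q \<noteq> insert (- x) Q" using x by blast
  then have card: "card ?F' = 2" by simp
  have int: "\<Inter>?F' = Q" using ne by auto
  have "clause_factor_of ?F' F"
  proof (rule clause_factorI[OF F])
    fix T assume T: "assignment T"
    show "\<exists>D\<in>?F'. (D - \<Inter>?F') \<inter> T = {}"
      unfolding int using assignmentD[OF T x0] x by (cases "x \<in> T") auto
  qed (use in_F in auto)
  then show False using irreducible_factor_cases[OF irr] card c by fastforce
qed

text \<open>The assignments falsifying a clause form a subcube, a smaller clause giving a larger
  one. If the cube of \<open>B\<close> is covered by two cubes, then one of them suffices or the two
  split it along a variable: making true some \<open>a\<close> in \<open>A1 - B\<close> and
  \<open>b\<close> in \<open>A2 - B\<close> with \<open>b\<close> different from \<open>- a\<close>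
  would leave both cubes.\<close>

lemma cube_cover_cases:
  assumes cl: "is_clause A1" "is_clause A2" "is_clause B"
    and cov: "\<And>T. assignment T \<Longrightarrow> B \<inter> T = {} \<Longrightarrow> A1 \<inter> T = {} \<or> A2 \<inter> T = {}"
  shows "A1 \<subseteq> B \<or> A2 \<subseteq> B \<or> (\<exists>a. A1 - B = {a} \<and> A2 - B = {- a})"
proof -
  have opp: "b = - a" if a: "a \<in> A1 - B" and b: "b \<in> A2 - B" for a b
  proof (rule ccontr)
    assume ne: "b \<noteq> - a"
    have a0: "a \<noteq> 0" "b \<noteq> 0" using a b is_clauseD(2) cl by auto
    obtain T where T: "assignment T" "(B \<union> {- a, - b}) \<inter> T = {}"
    proof (rule falsifying_assignment_exists[of "B \<union> {- a, - b}"])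
      show "0 \<notin> B \<union> {- a, - b}" using a0 is_clauseD(2)[OF cl(3)] by auto
      show "- x \<notin> B \<union> {- a, - b}" if "x \<in> B \<union> {- a, - b}" for x
        using that is_clauseD(3)[OF cl(3), of x] a b a0 ne by auto
    qed
    have "a \<in> T" "b \<in> T" using T(2) assignmentD[OF T(1)] a0 by auto
    then show False using cov[OF T(1)] T(2) a b by blast
  qed
  show ?thesis
  proof (cases "A1 \<subseteq> B \<or> A2 \<subseteq> B")
    case False
    then obtain a b where ab: "a \<in> A1 - B" "b \<in> A2 - B" by blast
    have 1: "A2 - B = {- a}" using opp[OF ab(1)] ab by blast
    have "A1 - B = {a}" using opp[of _ "- a"] ab 1 by (metis empty_iff insertI1 insert_iff is_singletonI' is_singleton_the_elem minus_equation_iff)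
    then show ?thesis using 1 by blast
  qed blast
qed

abbreviation covered_by :: "clause \<Rightarrow> clause \<Rightarrow> clause \<Rightarrow> bool" where
  "covered_by B A1 A2 \<equiv> A1 \<subseteq> B \<or> A2 \<subseteq> B \<or> (\<exists>a. A1 - B = {a} \<and> A2 - B = {- a})"

definition clash :: "clause \<Rightarrow> clause \<Rightarrow> bool" where
  "clash A B \<longleftrightarrow> (\<exists>x\<in>A. - x \<in> B)"

lemma clash_not_subset:
  assumes "clash A B" "is_clause A" "is_clause B" shows "\<not> A \<subseteq> B" "\<not> B \<subseteq> A"
  using assms is_clauseD unfolding clash_def by blast+

lemma clash_sym: "clash A B \<Longrightarrow> clash B A"
  unfolding clash_def by (metis minus_minus)

text \<open>The clash between \<open>A1\<close> and \<open>A2\<close> must be the splitting literal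
  of both \<open>B1\<close> and \<open>B2\<close>. Apart from it, \<open>A1\<close> and
  \<open>A2\<close> both turn out to equal the intersection of \<open>B1\<close> and
  \<open>B2\<close>.\<close>

lemma both_split_full_resolution:
  assumes cl: "is_clause A1" "is_clause A2" "is_clause B1" "is_clause B2"
    and clA: "clash A1 A2" and clB: "clash B1 B2"
    and covA: "covered_by A1 B1 B2" "covered_by A2 B1 B2"
    and s1: "A1 - B1 = {a}" "A2 - B1 = {- a}" and s2: "A1 - B2 = {a'}" "A2 - B2 = {- a'}"
  shows "full_resolution A1 A2"
proof -
  obtain z where z: "z \<in> A1" "- z \<in> A2" using clA by (auto simp: clash_def)
  have "z = a"
  proof (rule ccontr)
    assume "z \<noteq> a"
    then have "z \<in> B1" "- z \<in> B1" using z s1 by (blast, metis DiffI neg_equal_iff_equal singletonD)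
    then show False using is_clauseD(3)[OF cl(3)] by blast
  qed
  moreover have "z = a'"
  proof (rule ccontr)
    assume "z \<noteq> a'"
    then have "z \<in> B2" "- z \<in> B2" using z s2 by (blast, metis DiffI neg_equal_iff_equal singletonD)
    then show False using is_clauseD(3)[OF cl(4)] by blast
  qed
  ultimately have a': "a' = a" by simp
  have nB: "a \<notin> B1" "- a \<notin> B1" "a \<notin> B2" "- a \<notin> B2" using s1 s2 a' by auto
  have sub: "A1 \<subseteq> insert a (B1 \<inter> B2)" "A2 \<subseteq> insert (- a) (B1 \<inter> B2)" using s1 s2 a' by auto
  \<comment> \<open>The literal \<open>c\<close> stands for \<open>a\<close> when \<open>A\<close>
    is \<open>A1\<close> and for \<open>- a\<close> when \<open>A\<close> is
    \<open>A2\<close>.\<close>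
  have sup: "B1 \<inter> B2 \<subseteq> A" if h: "covered_by A B1 B2" "A \<subseteq> insert c (B1 \<inter> B2)" "c \<notin> B1" "c \<notin> B2" for A c
  proof -
    have "\<not> B1 \<subseteq> A" using h clash_not_subset(1)[OF clB cl(3,4)] by blast
    moreover have "\<not> B2 \<subseteq> A" using h clash_not_subset(2)[OF clB cl(3,4)] by blast
    ultimately obtain b where b: "B1 - A = {b}" "B2 - A = {- b}" using h(1) by blast
    then have "b \<noteq> - b" using is_clauseD(4)[OF cl(3), of b] by auto
    show ?thesis
    proof
      fix x assume "x \<in> B1 \<inter> B2"
      moreover from this have "x \<notin> A \<Longrightarrow> x = b \<and> x = - b" using b by auto
      ultimately show "x \<in> A" using \<open>b \<noteq> - b\<close> by blast
    qed
  qed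
  have "B1 \<inter> B2 \<subseteq> A1" "B1 \<inter> B2 \<subseteq> A2"
    using sup[OF covA(1) sub(1)] sup[OF covA(2) sub(2)] nB by blast+
  then have "A1 = insert a (B1 \<inter> B2)" "A2 = insert (- a) (B1 \<inter> B2)" using sub s1 by blast+
  then show ?thesis using nB unfolding full_resolution_def by blast
qed

text \<open>The case where one cube of the \<open>B\<close> pair lies inside a cube of the
  \<open>A\<close> pair and the other is split. Then \<open>B2\<close> lies in \<open>A2\<close>, so
  \<open>A1\<close> exceeds \<open>A2\<close> by at most \<open>a\<close>, while \<open>B1\<close>
  and \<open>B2\<close> exceed \<open>A1\<close> by \<open>p\<close> and \<open>- p\<close>.\<close>

lemma mixed_cover_bound:
  assumes cl: "is_clause A1" "is_clause A2" "is_clause B1" "is_clause B2"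
    and clA: "clash A1 A2" and clB: "clash B1 B2"
    and covA: "covered_by A1 B1 B2" "covered_by A2 B1 B2"
    and covB: "covered_by B1 A1 A2" "covered_by B2 A1 A2"
    and pairB: "\<not> full_resolution B1 B2"
    and ne: "A1 \<noteq> B1"
    and 1: "A1 \<subseteq> B1" and 2: "A1 - B2 = {a}" "A2 - B2 = {- a}"
  shows "\<exists>p. B1 \<union> B2 \<subseteq> (A1 \<inter> A2) \<union> {a, p, - p}"
proof -
  have n1: "\<not> B1 \<subseteq> A1" using ne 1 by blast
  have n2: "\<not> B2 \<subseteq> A1" using 1 clash_not_subset(2)[OF clB cl(3,4)] by blast
  obtain p where p: "B1 - A1 = {p}" "B2 - A1 = {- p}" using n1 n2 covA(1) by blast
  have n3: "\<not> B1 \<subseteq> A2" using 1 clash_not_subset(1)[OF clA cl(1,2)] by blast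
  have "B2 \<subseteq> A2"
  proof (rule ccontr)
    assume "\<not> B2 \<subseteq> A2"
    then obtain p' where p': "B1 - A2 = {p'}" "B2 - A2 = {- p'}" using n3 covA(2) by blast
    from both_split_full_resolution[OF cl(3,4,1,2) clB clA covB p p'] show False using pairB by blast
  qed
  then have "B1 \<union> B2 \<subseteq> (A1 \<inter> A2) \<union> {a, p, - p}" using p 2 1 by blast
  then show ?thesis by blast
qed

text \<open>Each of \<open>B1\<close> and \<open>B2\<close> either contains one of the
  \<open>A\<close> clauses or is split by them. Containment for both is impossible, and splitting
  for both makes \<open>A1\<close> and \<open>A2\<close> a full resolution pair. What remains is the
  mixed case up to exchanging names.\<close>

lemma two_covers_bound:
  assumes cl: "is_clause A1" "is_clause A2" "is_clause B1" "is_clause B2"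
    and clA: "clash A1 A2" and clB: "clash B1 B2"
    and covA: "covered_by A1 B1 B2" "covered_by A2 B1 B2"
    and covB: "covered_by B1 A1 A2" "covered_by B2 A1 A2"
    and pairA: "\<not> full_resolution A1 A2"
    and pairB: "\<not> full_resolution B1 B2"
    and ne: "A1 \<noteq> B1" "A1 \<noteq> B2" "A2 \<noteq> B1" "A2 \<noteq> B2"
  shows "\<exists>a p. B1 \<union> B2 \<subseteq> (A1 \<inter> A2) \<union> {a, p, - p}"
proof -
  have pairB': "\<not> full_resolution B2 B1" using pairB full_resolution_sym by blast
  have cov_sym: "covered_by X Z Y" if "covered_by X Y Z" for X Y Z using that by (metis minus_minus)
  have nA1B2: "\<not> (A1 \<subseteq> B1 \<and> A1 \<subseteq> B2)" and nA2B2: "\<not> (A2 \<subseteq> B1 \<and> A2 \<subseteq> B2)"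
    and x1: "\<not> (A1 \<subseteq> B1 \<and> A2 \<subseteq> B2)" and x2: "\<not> (A2 \<subseteq> B1 \<and> A1 \<subseteq> B2)"
  proof -
    \<comment> \<open>A clause \<open>X\<close> inside both \<open>B1\<close> and \<open>B2\<close>
      forces these to split \<open>Y\<close> at some \<open>b\<close>, and a literal of
      \<open>X\<close> outside \<open>Y\<close> would have to be both \<open>b\<close> and
      \<open>- b\<close>.\<close>
    have no1: False if c: "clash X Y" "is_clause X" "is_clause Y" "covered_by Y B1 B2" and s: "X \<subseteq> B1" "X \<subseteq> B2" for X Y
    proof -
      have nXY: "\<not> X \<subseteq> Y" using clash_not_subset(1)[OF c(1-3)] .
      then have "\<not> B1 \<subseteq> Y" "\<not> B2 \<subseteq> Y" using s by auto
      then obtain b where b: "B1 - Y = {b}" "B2 - Y = {- b}" using c(4) by blast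
      obtain x where x: "x \<in> X" "x \<notin> Y" using nXY by blast
      then have "x = b" "x = - b" using b s by auto
      then show False using is_clauseD(4)[OF c(2) x(1)] by simp
    qed
    \<comment> \<open>If the containments match the pairs up, \<open>B\<close> and \<open>B'\<close>
      split \<open>X\<close> at some \<open>b\<close>. The clash of \<open>X\<close> and
      \<open>Y\<close> must then be \<open>b\<close>, which is not in \<open>X\<close>.\<close>
    have no2: False if c: "clash X Y" "is_clause X" "is_clause Y" "covered_by X B B'" and s: "X \<subseteq> B" "Y \<subseteq> B'"
      and B: "clash B B'" "is_clause B" "is_clause B'" "X \<noteq> B" for X Y B B'
    proof -
      have "\<not> B \<subseteq> X" "\<not> B' \<subseteq> X" using s B(4) clash_not_subset[OF B(1-3)] by auto
      then obtain b where b: "B - X = {b}" "B' - X = {- b}" using c(4) by blast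
      obtain z where z: "z \<in> X" "- z \<in> Y" using c(1) by (auto simp: clash_def)
      then have "- z \<notin> X" using is_clauseD(3)[OF c(2)] by blast
      then have "- z = - b" using z s b by blast
      then show False using z b by auto
    qed
    show "\<not> (A1 \<subseteq> B1 \<and> A1 \<subseteq> B2)" using no1[OF clA cl(1,2) covA(2)] by blast
    show "\<not> (A2 \<subseteq> B1 \<and> A2 \<subseteq> B2)" using no1[OF clash_sym[OF clA] cl(2,1) covA(1)] by blast
    show "\<not> (A1 \<subseteq> B1 \<and> A2 \<subseteq> B2)" using no2[OF clA cl(1,2) covA(1) _ _ clB cl(3,4) ne(1)] by blast
    show "\<not> (A2 \<subseteq> B1 \<and> A1 \<subseteq> B2)" using no2[OF clash_sym[OF clA] cl(2,1) covA(2) _ _ clB cl(3,4) ne(3)] by blast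
  qed
  show ?thesis
  proof (cases "A1 \<subseteq> B1 \<or> A2 \<subseteq> B1")
    case True
    then have "\<not> A1 \<subseteq> B2" "\<not> A2 \<subseteq> B2" using nA1B2 nA2B2 x1 x2 by auto
    then obtain a where a: "A1 - B2 = {a}" "A2 - B2 = {- a}" using covB(2) by blast
    from True show ?thesis
    proof
      assume s: "A1 \<subseteq> B1"
      show ?thesis using mixed_cover_bound[OF cl clA clB covA covB pairB ne(1) s a] by (rule exI)
    next
      assume s: "A2 \<subseteq> B1"
      have e: "A1 - B2 = {- (- a)}" using a by simp
      show ?thesis
        using mixed_cover_bound[OF cl(2,1,3,4) clash_sym[OF clA] clB covA(2,1)
            cov_sym[OF covB(1)] cov_sym[OF covB(2)] pairB ne(3) s a(2) e]
        unfolding Int_commute[of A2 A1] by (rule exI)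
    qed
  next
    case False
    then obtain a where a: "A1 - B1 = {a}" "A2 - B1 = {- a}" using covB(1) by blast
    have "A1 \<subseteq> B2 \<or> A2 \<subseteq> B2"
    proof (rule ccontr)
      assume "\<not> ?thesis"
      then obtain a' where a': "A1 - B2 = {a'}" "A2 - B2 = {- a'}" using covB(2) by blast
      from both_split_full_resolution[OF cl clA clB covA a a'] show False using pairA by blast
    qed
    then show ?thesis
    proof
      assume s: "A1 \<subseteq> B2"
      from mixed_cover_bound[OF cl(1,2,4,3) clA clash_sym[OF clB] cov_sym[OF covA(1)] cov_sym[OF covA(2)] covB(2,1) pairB' ne(2) s a]
      show ?thesis unfolding Un_commute[of B2 B1] by (rule exI)
    next
      assume s: "A2 \<subseteq> B2"
      have e: "A1 - B1 = {- (- a)}" using a by simp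
      from mixed_cover_bound[OF cl(2,1,4,3) clash_sym[OF clA] clash_sym[OF clB] cov_sym[OF covA(2)] cov_sym[OF covA(1)]
          cov_sym[OF covB(2)] cov_sym[OF covB(1)] pairB' ne(4) s a(2) e]
      show ?thesis unfolding Un_commute[of B2 B1] Int_commute[of A2 A1] by (rule exI)
    qed
  qed
qed

text \<open>Make \<open>x\<close> true. If the clause falsified then did not contain
  \<open>- x\<close>, it would also be falsified with \<open>x\<close> false, together with
  \<open>D\<close>. So the clauses through \<open>x\<close> and those through \<open>- x\<close>
  cover the same assignments once this literal is deleted.\<close>

lemma opposite_side_falsified:
  assumes F: "unsat_hitting F" and T: "assignment T" and D: "D \<in> F" "x \<in> D" "(D - {x}) \<inter> T = {}"
  obtains E where "E \<in> F" "- x \<in> E" "(E - {- x}) \<inter> T = {}"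
proof -
  note clD = is_clauseD[OF unsat_hittingD(2)[OF F D(1)]]
  have x0: "x \<noteq> 0" and nx: "- x \<notin> D" using clD(3,4)[OF D(2)] by auto
  have T1: "assignment (set_true (- x) T)" and T2: "assignment (set_true x T)"
    using assignment_set_true[OF T] x0 by auto
  have D1: "D \<inter> set_true (- x) T = {}" using D nx by (auto simp: set_true_def)
  obtain E where E: "E \<in> F" "E \<inter> set_true x T = {}" using unsat_hittingD(4)[OF F T2] by blast
  have xE: "x \<notin> E" using E by (auto simp: set_true_def)
  have "- x \<in> E"
  proof (rule ccontr)
    assume "- x \<notin> E"
    then have "E \<inter> set_true (- x) T = {}" using E by (auto simp: set_true_def)
    then have "E = D" using falsified_unique[OF F E(1) D(1) T1] D1 by blast
    then show False using xE D by blast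
  qed
  moreover have "(E - {- x}) \<inter> T = {}" using E by (auto simp: set_true_def)
  ultimately show thesis using that E by blast
qed

text \<open>A variable \<open>v\<close> of minimal degree occurs in exactly two clauses of each sign. The two clauses
  of either sign cover the same region after deleting \<open>v\<close>, which leaves at most three unit literals
  in the restriction, a clause-set of deficiency 1.\<close>

lemma irreducible_deficiency_2:
  assumes irr: "clause_irreducible F" and F: "unsat_hitting F" and d: "deficiency F = 2"
  shows "nvars F \<le> 3"
proof (cases "nvars F \<le> 1")
  case False
  then have n: "nvars F \<noteq> 0" by simp
  have nons: "nonsingular F" using irreducible_nonsingular[OF irr F] d by simp
  have c: "card F \<noteq> 2" using d False by (simp add: deficiency_def)
  obtain v where v: "v \<in> vars F" "Suc (nvars (restr F (- v))) = nvars F"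
    "deficiency F = deficiency (restr F (- v)) + int (ldeg F (- v)) - 1"
    "int (ldeg F v) \<le> deficiency F" "int (ldeg F (- v)) \<le> deficiency F"
    using min_degree_variable_deficiency[OF F n] .
  have v0: "v \<noteq> 0" and va: "\<bar>v\<bar> \<in> vars F" "\<bar>- v\<bar> \<in> vars F" using v(1) by (auto simp: vars_def)
  \<comment> \<open>Each degree is positive, at most the deficiency 2, and not 1.\<close>
  have two: "ldeg F v = 2" "ldeg F (- v) = 2"
    using v(4,5) d ldeg_pos[OF F va(1)] ldeg_pos[OF F va(2)]
      nonsingular_ldeg[OF F nons, of v] nonsingular_ldeg[OF F nons, of "- v"] by linarith+
  let ?R = "restr F (- v)"
  have R: "unsat_hitting ?R" using unsat_hitting_restr[OF F] v0 by simp
  have "deficiency ?R = 1" using v(3) two d by simp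
  then have less: "nvars ?R < card (unit_lits ?R)" using nvars_less_unit_lits[OF R] v(2) False by simp
  obtain A1 A2 where A: "{C \<in> F. v \<in> C} = {A1, A2}" "A1 \<noteq> A2"
    using two(1) unfolding ldeg_def card_2_iff by blast
  obtain B1 B2 where B: "{C \<in> F. - v \<in> C} = {B1, B2}" "B1 \<noteq> B2"
    using two(2) unfolding ldeg_def card_2_iff by blast
  have inA: "A1 \<in> F" "A2 \<in> F" "v \<in> A1" "v \<in> A2" using A(1) by blast+
  have inB: "B1 \<in> F" "B2 \<in> F" "- v \<in> B1" "- v \<in> B2" using B(1) by blast+
  note cl = unsat_hittingD(2)[OF F]
  have vA: "- v \<notin> A1" "- v \<notin> A2" using is_clauseD(3)[OF cl] inA by blast+
  have vB: "v \<notin> B1" "v \<notin> B2" using is_clauseD(5)[OF cl] inB by blast+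
  define a1 a2 b1 b2 where "a1 = A1 - {v}" and "a2 = A2 - {v}" and "b1 = B1 - {- v}" and "b2 = B2 - {- v}"
  note defs = a1_def a2_def b1_def b2_def
  have ins: "A1 = insert v a1" "A2 = insert v a2" "B1 = insert (- v) b1" "B2 = insert (- v) b2"
    and out: "v \<notin> a1" "v \<notin> a2" "v \<notin> b1" "v \<notin> b2" "- v \<notin> a1" "- v \<notin> a2" "- v \<notin> b1" "- v \<notin> b2"
    using inA inB vA vB unfolding defs by blast+
  have cls: "is_clause a1" "is_clause a2" "is_clause b1" "is_clause b2"
    using is_clause_subset[OF cl[OF inA(1)], of a1] is_clause_subset[OF cl[OF inA(2)], of a2]
      is_clause_subset[OF cl[OF inB(1)], of b1] is_clause_subset[OF cl[OF inB(2)], of b2]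
    unfolding ins by blast+
  have clash: "clash (C - {x}) (D - {x})"
    if h: "C \<in> F" "D \<in> F" "C \<noteq> D" "- x \<notin> C" "- x \<notin> D" for C D x
  proof -
    obtain z where z: "z \<in> C" "- z \<in> D" using unsat_hittingD(3)[OF F h(1-3)] by blast
    then have "z \<noteq> x" "- z \<noteq> x" using h(4,5) by auto
    then show ?thesis using z unfolding clash_def by blast
  qed
  have clA: "clash a1 a2" and clB: "clash b1 b2"
    using clash[OF inA(1,2) A(2) vA] clash[OF inB(1,2) B(2)] vB unfolding defs by simp_all
  have fB: "a1 \<inter> T = {} \<or> a2 \<inter> T = {}" if h: "assignment T" "D \<in> {B1, B2}" "(D - {- v}) \<inter> T = {}" for T D
  proof -
    have "D \<in> F" "- v \<in> D" using h(2) B(1) by blast+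
    then obtain E where "E \<in> F" "v \<in> E" "(E - {v}) \<inter> T = {}"
      using opposite_side_falsified[OF F h(1) _ _ h(3)] by (metis minus_minus)
    then show ?thesis using A(1) unfolding defs by blast
  qed
  have fA: "b1 \<inter> T = {} \<or> b2 \<inter> T = {}" if h: "assignment T" "D \<in> {A1, A2}" "(D - {v}) \<inter> T = {}" for T D
  proof -
    have "D \<in> F" "v \<in> D" using h(2) A(1) by blast+
    then obtain E where "E \<in> F" "- v \<in> E" "(E - {- v}) \<inter> T = {}"
      using opposite_side_falsified[OF F h(1) _ _ h(3)] by metis
    then show ?thesis using B(1) unfolding defs by blast
  qed
  have covB: "covered_by b1 a1 a2" "covered_by b2 a1 a2"
    by (intro cube_cover_cases cls, use fB[of _ B1] b1_def in blast)
       (intro cube_cover_cases cls, use fB[of _ B2] b2_def in blast)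
  have covA: "covered_by a1 b1 b2" "covered_by a2 b1 b2"
    by (intro cube_cover_cases cls, use fA[of _ A1] a1_def in blast)
       (intro cube_cover_cases cls, use fA[of _ A2] a2_def in blast)
  note no_res = irreducible_no_full_resolution[OF irr F c]
  have resA: "\<not> full_resolution a1 a2"
    using full_resolution_insert[of a1 a2 v] no_res[OF inA(1,2)] out unfolding ins by blast
  have resB: "\<not> full_resolution b1 b2"
    using full_resolution_insert[of b1 b2 "- v"] no_res[OF inB(1,2)] out unfolding ins by blast
  \<comment> \<open>If the two sides had a clause in common after deleting \<open>v\<close>, the
    originals would be a full resolution pair.\<close>
  have ne: "a \<noteq> b" if "insert v a \<in> F" "insert (- v) b \<in> F" "v \<notin> a" "- v \<notin> a" for a b
    using no_res[OF that(1,2)] that(3,4) unfolding full_resolution_def by blast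
  have ne: "a1 \<noteq> b1" "a1 \<noteq> b2" "a2 \<noteq> b1" "a2 \<noteq> b2"
    using ne inA(1,2) inB(1,2) out unfolding ins by blast+
  obtain a p where ap: "b1 \<union> b2 \<subseteq> (a1 \<inter> a2) \<union> {a, p, - p}"
    using two_covers_bound[OF cls clA clB covA covB resA resB ne] by (elim exE) (rule that)
  have "unit_lits ?R \<subseteq> {a, p, - p}"
  proof
    fix y assume y: "y \<in> unit_lits ?R"
    then have yv: "y \<noteq> v" "y \<noteq> - v"
      using ldeg_restr_self(1)[of F "- v"] ldeg_restr_self(2)[of "- v" F] v0 by (auto simp: unit_lits_def)
    then have one: "card {C \<in> F. - v \<notin> C \<and> y \<in> C} = 1"
      using y ldeg_restr[OF F, of y "- v"] by (simp add: unit_lits_def)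
    \<comment> \<open>A unit literal of the restriction has lost an occurrence, as \<open>F\<close>
      is nonsingular, so it lies in \<open>b1\<close> or \<open>b2\<close>. It cannot lie in both
      \<open>a1\<close> and \<open>a2\<close>, since these clauses remain.\<close>
    have "{C \<in> F. - v \<notin> C \<and> y \<in> C} \<noteq> {C \<in> F. y \<in> C}"
      using one nonsingular_ldeg[OF F nons, of y] unfolding ldeg_def by metis
    then obtain D where "D \<in> F" "- v \<in> D" "y \<in> D" by blast
    then have "y \<in> B1 \<or> y \<in> B2" using B(1) by blast
    then have "y \<in> b1 \<union> b2" using yv unfolding defs by blast
    moreover have "y \<notin> a1 \<inter> a2"
    proof
      assume "y \<in> a1 \<inter> a2"
      then have "{A1, A2} \<subseteq> {C \<in> F. - v \<notin> C \<and> y \<in> C}" using inA vA unfolding defs by blast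
      then have "card {A1, A2} \<le> card {C \<in> F. - v \<notin> C \<and> y \<in> C}"
        using unsat_hittingD(1)[OF F] by (intro card_mono) auto
      then show False using A(2) one by simp
    qed
    ultimately show "y \<in> {a, p, - p}" using ap by blast
  qed
  then have "card (unit_lits ?R) \<le> card {a, p, - p}" by (intro card_mono) auto
  also have "\<dots> \<le> 3" by (simp add: card_insert_if)
  finally show ?thesis using less v(2) by linarith
qed simp

section \<open>A lower bound on N\<close>

definition join :: "int \<Rightarrow> clause_set \<Rightarrow> clause_set \<Rightarrow> clause_set" where
  "join v F G = insert v ` F \<union> insert (- v) ` G"

context
  fixes v :: int and F G :: clause_set
  assumes F: "unsat_hitting F" and G: "unsat_hitting G" and v: "v > 0" "v \<notin> vars F" "v \<notin> vars G"
begin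

lemma join_fresh: "C \<in> F \<union> G \<Longrightarrow> v \<notin> C" "C \<in> F \<union> G \<Longrightarrow> - v \<notin> C"
  using v by (auto simp: vars_def)

lemma unsat_hitting_join: "unsat_hitting (join v F G)"
  unfolding unsat_hitting_iff
proof (intro conjI allI impI)
  have "is_clause (insert x C)" if "C \<in> F \<union> G" "x \<in> {v, - v}" for x C
    using that v(1) join_fresh[OF that(1)] unsat_hittingD(2)[OF F] unsat_hittingD(2)[OF G]
    by (auto simp: is_clause_def)
  then show "is_clause_set (join v F G)"
    using unsat_hittingD(1)[OF F] unsat_hittingD(1)[OF G] by (auto simp: is_clause_set_def join_def)
  show "hitting (join v F G)" unfolding hitting_def
  proof (intro ballI impI)
    fix C D assume C: "C \<in> join v F G" and D: "D \<in> join v F G" and ne: "C \<noteq> D"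
    consider c d where "C = insert v c" "D = insert v d" "c \<in> F" "d \<in> F"
      | c d where "C = insert (- v) c" "D = insert (- v) d" "c \<in> G" "d \<in> G"
      | "v \<in> C" "- v \<in> D" | "- v \<in> C" "v \<in> D"
      using C D unfolding join_def by auto
    then show "\<exists>x\<in>C. - x \<in> D"
    proof cases
      case 1
      then have "c \<noteq> d" using ne by blast
      then show ?thesis using unsat_hittingD(3)[OF F] 1 by blast
    next
      case 2
      then have "c \<noteq> d" using ne by blast
      then show ?thesis using unsat_hittingD(3)[OF G] 2 by blast
    next
      case 4
      then show ?thesis by (metis minus_minus)
    qed blast
  qed
  fix T assume T: "assignment T"
  show "\<exists>D\<in>join v F G. D \<inter> T = {}"
  proof (cases "v \<in> T")
    case True
    then have "- v \<notin> T" using assignmentD[OF T, of v] v(1) by blast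
    moreover obtain D where "D \<in> G" "D \<inter> T = {}" using unsat_hittingD(4)[OF G T] by blast
    ultimately have "insert (- v) D \<inter> T = {}" "insert (- v) D \<in> join v F G" by (auto simp: join_def)
    then show ?thesis by blast
  next
    case False
    moreover obtain D where "D \<in> F" "D \<inter> T = {}" using unsat_hittingD(4)[OF F T] by blast
    ultimately have "insert v D \<inter> T = {}" "insert v D \<in> join v F G" by (auto simp: join_def)
    then show ?thesis by blast
  qed
qed

lemma inj_join: "inj_on (insert v) F" "inj_on (insert (- v)) G"
  using join_fresh by (auto intro!: inj_onI dest: insert_ident[THEN iffD1, rotated 2])

lemma card_join: "card (join v F G) = card F + card G"
proof -
  have "insert v ` F \<inter> insert (- v) ` G = {}"
  proof -
    have "insert v C \<noteq> insert (- v) D" if "C \<in> F" "D \<in> G" for C D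
      using join_fresh(1)[of D] that v(1) by (metis UnI2 insertCI insertE neg_equal_zero order_less_irrefl)
    then show ?thesis by blast
  qed
  then show ?thesis unfolding join_def
    using unsat_hittingD(1)[OF F] unsat_hittingD(1)[OF G] inj_join by (simp add: card_Un_disjoint card_image)
qed

lemma vars_join: "vars (join v F G) = insert v (vars F \<union> vars G)"
proof -
  obtain T where "assignment T" using falsifying_assignment_exists[of "{}"] by blast
  then have "F \<noteq> {}" using unsat_hittingD(4)[OF F] by blast
  moreover have "w \<in> insert v C \<or> - w \<in> insert v C \<longleftrightarrow> w = v \<or> w \<in> C \<or> - w \<in> C"
    "w \<in> insert (- v) C \<or> - w \<in> insert (- v) C \<longleftrightarrow> w = v \<or> w \<in> C \<or> - w \<in> C"
    if "w > 0" for w C using that v(1) by auto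
  ultimately have *: "w > 0 \<Longrightarrow> (\<exists>C\<in>join v F G. w \<in> C \<or> - w \<in> C) \<longleftrightarrow>
      w = v \<or> (\<exists>C\<in>F. w \<in> C \<or> - w \<in> C) \<or> (\<exists>C\<in>G. w \<in> C \<or> - w \<in> C)" for w
    unfolding join_def bex_Un bex_simps by (simp only:) blast
  show ?thesis
  proof (rule set_eqI)
    fix w
    show "w \<in> vars (join v F G) \<longleftrightarrow> w \<in> insert v (vars F \<union> vars G)"
    proof (cases "w > 0")
      case True
      then show ?thesis unfolding vars_def Un_iff insert_iff mem_Collect_eq *[OF True] by argo
    next
      case False
      then have "w \<noteq> v" using v(1) by blast
      with False show ?thesis unfolding vars_def Un_iff insert_iff mem_Collect_eq by argo
    qed
  qed
qed

lemma ldeg_join: "ldeg F y \<le> ldeg (join v F G) y" "ldeg G y \<le> ldeg (join v F G) y"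
  "ldeg (join v F G) v \<ge> card F" "ldeg (join v F G) (- v) \<ge> card G"
proof -
  have fin: "finite (join v F G)" using unsat_hittingD(1)[OF unsat_hitting_join] .
  have *: "card H \<le> ldeg (join v F G) z"
    if "inj_on f H" "\<And>C. C \<in> H \<Longrightarrow> f C \<in> join v F G \<and> z \<in> f C" for f z and H :: clause_set
    unfolding ldeg_def using that fin by (intro card_inj_on_le[of f]) auto
  show "ldeg F y \<le> ldeg (join v F G) y" unfolding ldeg_def[of F]
    by (rule *[of "insert v"]) (auto intro: inj_on_subset[OF inj_join(1)] simp: join_def)
  show "ldeg G y \<le> ldeg (join v F G) y" unfolding ldeg_def[of G]
    by (rule *[of "insert (- v)"]) (auto intro: inj_on_subset[OF inj_join(2)] simp: join_def)
  show "ldeg (join v F G) v \<ge> card F" by (rule *[OF inj_join(1)]) (auto simp: join_def)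
  show "ldeg (join v F G) (- v) \<ge> card G" by (rule *[OF inj_join(2)]) (auto simp: join_def)
qed

end

text \<open>The three binary clauses are the implications from \<open>a\<close> to \<open>b\<close>
  to \<open>c\<close> and back to \<open>a\<close>, which force equal values; the two long clauses
  exclude all false and all true. With 5 clauses on 3 variables the deficiency is 2.\<close>

definition triangle :: "int \<Rightarrow> int \<Rightarrow> int \<Rightarrow> clause_set" where
  "triangle a b c = {{a, b, c}, {- a, - b, - c}, {- a, b}, {- b, c}, {- c, a}}"

lemma triangle_props:
  assumes "0 < a" "a < b" "b < c"
  shows "unsat_hitting (triangle a b c)" "card (triangle a b c) = 5" "vars (triangle a b c) = {a, b, c}"
    "\<bar>y\<bar> \<in> {a, b, c} \<Longrightarrow> 2 \<le> ldeg (triangle a b c) y"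
proof -
  have dist: "{a, b, c} \<noteq> {- a, - b, - c}" "{a, b, c} \<noteq> {- a, b}" "{a, b, c} \<noteq> {- b, c}" "{a, b, c} \<noteq> {- c, a}"
    "{- a, - b, - c} \<noteq> {- a, b}" "{- a, - b, - c} \<noteq> {- b, c}" "{- a, - b, - c} \<noteq> {- c, a}"
    "{- a, b} \<noteq> {- b, c}" "{- a, b} \<noteq> {- c, a}" "{- b, c} \<noteq> {- c, a}"
  proof -
    have "a \<notin> {- a, - b, - c}" "b \<notin> {- a, - b, - c}" "c \<notin> {- a, - b, - c}"
      "a \<notin> {- a, b}" "a \<notin> {- b, c}" "b \<notin> {- c, a}" "c \<notin> {- a, b}" "c \<notin> {- c, a}"
      using assms by auto
    then show "{a, b, c} \<noteq> {- a, - b, - c}" "{a, b, c} \<noteq> {- a, b}" "{a, b, c} \<noteq> {- b, c}" "{a, b, c} \<noteq> {- c, a}"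
    "{- a, - b, - c} \<noteq> {- a, b}" "{- a, - b, - c} \<noteq> {- b, c}" "{- a, - b, - c} \<noteq> {- c, a}"
    "{- a, b} \<noteq> {- b, c}" "{- a, b} \<noteq> {- c, a}" "{- b, c} \<noteq> {- c, a}"
      by blast+
  qed
  show "card (triangle a b c) = 5" unfolding triangle_def using dist by simp
  show "vars (triangle a b c) = {a, b, c}" using assms by (auto simp: vars_def triangle_def)
  show "unsat_hitting (triangle a b c)" unfolding unsat_hitting_iff
  proof (intro conjI allI impI)
    show "is_clause_set (triangle a b c)" using assms by (auto simp: is_clause_set_def is_clause_def triangle_def)
    show "hitting (triangle a b c)" by (auto simp: hitting_def triangle_def)
    fix T assume T: "assignment T"
    have "- a \<in> T \<longleftrightarrow> a \<notin> T" "- b \<in> T \<longleftrightarrow> b \<notin> T" "- c \<in> T \<longleftrightarrow> c \<notin> T"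
      using assignmentD[OF T] assms by auto
    then show "\<exists>D\<in>triangle a b c. D \<inter> T = {}" by (auto simp: triangle_def)
  qed
  have fin: "finite (triangle a b c)" by (simp add: triangle_def)
  have *: "2 \<le> ldeg (triangle a b c) y"
    if "C \<in> triangle a b c" "D \<in> triangle a b c" "C \<noteq> D" "y \<in> C" "y \<in> D" for C D y
  proof -
    have "card {C, D} \<le> ldeg (triangle a b c) y"
      unfolding ldeg_def using fin that by (intro card_mono) auto
    then show ?thesis using that by simp
  qed
  show "2 \<le> ldeg (triangle a b c) y" if "\<bar>y\<bar> \<in> {a, b, c}"
  proof -
    have "y \<in> {a, b, c, - a, - b, - c}" using that by auto
    then consider "y = a" | "y = b" | "y = c" | "y = - a" | "y = - b" | "y = - c" by blast
    then show ?thesis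
    proof cases
      case 1
      then show ?thesis using *[of "{a, b, c}" "{- c, a}"] dist by (simp add: triangle_def)
    next
      case 2
      then show ?thesis using *[of "{a, b, c}" "{- a, b}"] dist by (simp add: triangle_def)
    next
      case 3
      then show ?thesis using *[of "{a, b, c}" "{- b, c}"] dist by (simp add: triangle_def)
    next
      case 4
      then show ?thesis using *[of "{- a, - b, - c}" "{- a, b}"] dist by (simp add: triangle_def)
    next
      case 5
      then show ?thesis using *[of "{- a, - b, - c}" "{- b, c}"] dist by (simp add: triangle_def)
    next
      case 6
      then show ?thesis using *[of "{- a, - b, - c}" "{- c, a}"] dist by (simp add: triangle_def)
    qed
  qed
qed

lemma nonsingular_example:
  fixes j :: nat
  obtains F where "unsat_hitting F" "vars F = {1..4 * int j + 3}" "card F = 5 * j + 5"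
    "\<And>y. \<bar>y\<bar> \<in> vars F \<Longrightarrow> 2 \<le> ldeg F y"
proof -
  have "\<exists>F. unsat_hitting F \<and> vars F = {1..4 * int j + 3} \<and> card F = 5 * j + 5
    \<and> (\<forall>y. \<bar>y\<bar> \<in> vars F \<longrightarrow> 2 \<le> ldeg F y)"
  proof (induction j)
    case 0
    have "{1..4 * int 0 + 3} = {1, 2, 3}" by auto
    then show ?case using triangle_props[of 1 2 3] by (intro exI[of _ "triangle 1 2 3"]) simp
  next
    case (Suc j)
    then obtain F where F: "unsat_hitting F" "vars F = {1..4 * int j + 3}" "card F = 5 * j + 5"
      "\<And>y. \<bar>y\<bar> \<in> vars F \<Longrightarrow> 2 \<le> ldeg F y" by blast
    define v where "v = 4 * int j + 4"
    let ?G = "triangle (v + 1) (v + 2) (v + 3)"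
    note G = triangle_props[of "v + 1" "v + 2" "v + 3"]
    have vp: "v > 0" "v \<notin> vars F" "v \<notin> vars ?G" using F(2) G(3) by (auto simp: v_def)
    have ord: "0 < v + 1" "v + 1 < v + 2" "v + 2 < v + 3" using vp by auto
    note G = G[OF ord]
    note jn = F(1) G(1) vp
    have "vars (join v F ?G) = {1..4 * int (Suc j) + 3}"
      unfolding vars_join[OF jn] F(2) G(3) by (auto simp: v_def)
    moreover have "card (join v F ?G) = 5 * Suc j + 5" using card_join[OF jn] F(3) G(2) by simp
    moreover have "2 \<le> ldeg (join v F ?G) y" if "\<bar>y\<bar> \<in> vars (join v F ?G)" for y
    proof -
      consider "\<bar>y\<bar> \<in> vars F" | "\<bar>y\<bar> \<in> {v + 1, v + 2, v + 3}" | "y = v" | "y = - v"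
        using \<open>\<bar>y\<bar> \<in> _\<close> unfolding vars_join[OF jn] G(3) by (auto simp: abs_if split: if_splits)
      then show ?thesis
      proof cases
        case 1
        then show ?thesis using F(4) ldeg_join(1)[OF jn] le_trans by blast
      next
        case 2
        then show ?thesis using G(4) ldeg_join(2)[OF jn] le_trans by blast
      next
        case 3
        then show ?thesis using ldeg_join(3)[OF jn] F(3) by simp
      next
        case 4
        then show ?thesis using ldeg_join(4)[OF jn] G(2) by simp
      qed
    qed
    ultimately show ?case using unsat_hitting_join[OF jn] by blast
  qed
  then show thesis using that by blast
qed

section \<open>Bounds on the supremum\<close>

lemma N_le_iff:
  "N k \<le> enat b \<longleftrightarrow> (\<forall>F. unsat_hitting F \<and> nonsingular F \<and> deficiency F = int k \<longrightarrow> nvars F \<le> b)"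
  unfolding N_def by (simp add: SUP_le_iff)

lemma N_ge:
  assumes "k \<ge> 2" shows "enat (4 * k - 5) \<le> N k"
proof -
  obtain j where j: "k = j + 2" using assms by (metis add.commute le_Suc_ex)
  obtain F where F: "unsat_hitting F" "vars F = {1..4 * int j + 3}" "card F = 5 * j + 5"
    "\<And>y. \<bar>y\<bar> \<in> vars F \<Longrightarrow> 2 \<le> ldeg F y" using nonsingular_example by metis
  have n: "nvars F = 4 * k - 5" using F(2) j by (simp add: nvars_def)
  have "nonsingular F" unfolding nonsingular_def singular_var_def
  proof (intro allI notI)
    fix v assume v: "v \<in> vars F \<and> min (ldeg F v) (ldeg F (- v)) = 1"
    then have "\<bar>v\<bar> \<in> vars F" "\<bar>- v\<bar> \<in> vars F" by (auto simp: vars_def)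
    then have "2 \<le> ldeg F v" "2 \<le> ldeg F (- v)" using F(4) by blast+
    then show False using v by (simp add: min_def split: if_splits)
  qed
  moreover have "deficiency F = int k" using F(3) n j by (simp add: deficiency_def)
  ultimately show ?thesis using F(1) n unfolding N_def by (intro SUP_upper2[of F]) auto
qed

section \<open>The equivalences\<close>

text \<open>A nonsingular clause-set has no unit literals, so \<open>nvars_bound\<close> loses its
  last term. Deficiency 2 is supplied by \<open>irreducible_deficiency_2\<close>, as 3 is below
  \<open>m 1\<close>.\<close>

lemma N_bound:
  fixes m :: "nat \<Rightarrow> nat"
  assumes mono: "mono m" and m4: "\<And>j. 4 \<le> m j"
    and irred: "\<And>F j. clause_irreducible F \<Longrightarrow> unsat_hitting F \<Longrightarrow> deficiency F = int j + 1 \<Longrightarrow> 2 \<le> j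
      \<Longrightarrow> nvars F < j * m j"
  shows "N (Suc j) \<le> enat (j * m j - 1)"
  unfolding N_le_iff
proof (intro allI impI, elim conjE)
  fix F assume F: "unsat_hitting F" "nonsingular F" "deficiency F = int (Suc j)"
  have ir: "nvars H < i * m i"
    if H: "clause_irreducible H" "unsat_hitting H" "deficiency H = int i + 1" "1 \<le> i" for H i
  proof (cases "i = 1")
    case True
    then have "nvars H \<le> 3" using irreducible_deficiency_2 H by simp
    then show ?thesis using m4[of 1] True by simp
  next
    case False
    then show ?thesis using irred[OF H(1-3)] H(4) by simp
  qed
  show "nvars F \<le> j * m j - 1"
  proof (cases "nvars F = 0")
    case False
    have "unit_lits F = {}" using nonsingular_ldeg[OF F(1,2)] by (simp add: unit_lits_def)
    moreover have "nvars F < j * m j + card (unit_lits F)"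
      by (rule nvars_bound[OF mono m4 ir F(1) False]) (use F(3) in auto)
    ultimately have "nvars F < j * m j" by simp
    then show ?thesis by simp
  qed simp
qed

theorem corollary9:
  shows
    "((\<forall>k::nat. k \<ge> 1 \<longrightarrow> N k < \<infinity>) \<longleftrightarrow>
      (\<forall>k::nat. k \<ge> 3 \<longrightarrow>
        (SUP F \<in> {F. clause_irreducible F \<and> unsat_hitting F \<and> deficiency F = int k}.
          enat (nvars F)) < \<infinity>))
     \<and>
     ((\<forall>k::nat. k \<ge> 2 \<longrightarrow> N k = enat (4 * k - 5)) \<longleftrightarrow>
      (\<forall>k::nat. k \<ge> 3 \<longrightarrow>
        (\<forall>F. clause_irreducible F \<and> unsat_hitting F \<and> deficiency F = int k \<longrightarrow>
          nvars F \<le> 4 * k - 5)))"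
proof -
  let ?I = "\<lambda>k::nat. {F. clause_irreducible F \<and> unsat_hitting F \<and> deficiency F = int k}"
  let ?S = "\<lambda>k. (SUP F \<in> ?I k. enat (nvars F))"
  have I_le_N: "?S k \<le> N k" if "k \<ge> 2" for k
    unfolding N_def using that irreducible_nonsingular by (intro SUP_subset_mono) auto
  have "?S k < \<infinity>" if "\<forall>k\<ge>1. N k < \<infinity>" "k \<ge> 3" for k
  proof -
    have "k \<ge> 2" "k \<ge> 1" using that(2) by auto
    then show ?thesis using I_le_N that(1) le_less_trans by blast
  qed
  moreover have "N k < \<infinity>" if fin: "\<forall>k\<ge>3. ?S k < \<infinity>" and k: "k \<ge> 1" for k
  proof -
    define f where "f k = the_enat (?S k)" for k
    have f: "nvars F \<le> f k" if "F \<in> ?I k" "k \<ge> 3" for F k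
    proof -
      have "?S k < \<infinity>" using fin that(2) by blast
      then obtain b where b: "?S k = enat b" by (rule less_infinityE)
      have "enat (nvars F) \<le> ?S k" using that(1) by (rule SUP_upper)
      then show ?thesis unfolding f_def b by simp
    qed
    \<comment> \<open>Partial sums give a monotone majorant of \<open>f\<close>. The index is
      shifted because \<open>j\<close> is the deficiency minus 1; the terms \<open>f 1\<close> and
      \<open>f 2\<close>, on which nothing is assumed, are natural numbers in any case and only
      enlarge \<open>m\<close>.\<close>
    define m where "m j = 4 + (\<Sum>i\<le>j. f (Suc i))" for j
    have "mono m" unfolding m_def by (intro monoI add_left_mono sum_mono2) auto
    moreover have "4 \<le> m j" for j by (simp add: m_def)
    moreover have "nvars F < j * m j"
      if "clause_irreducible F" "unsat_hitting F" "deficiency F = int j + 1" "2 \<le> j" for F j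
    proof -
      have "nvars F \<le> f (Suc j)" using that by (intro f) auto
      also have "f (Suc j) \<le> (\<Sum>i\<le>j. f (Suc i))" by (rule member_le_sum) auto
      also have "\<dots> < m j" by (simp add: m_def)
      also have "m j \<le> j * m j" using that(4) by simp
      finally show ?thesis .
    qed
    ultimately have "N (Suc (k - 1)) \<le> enat ((k - 1) * m (k - 1) - 1)" by (rule N_bound)
    also have "\<dots> < \<infinity>" by simp
    finally show ?thesis using k by simp
  qed
  moreover have "nvars F \<le> 4 * k - 5"
    if eq: "\<forall>k\<ge>2. N k = enat (4 * k - 5)" and k: "k \<ge> 3"
      and F: "clause_irreducible F \<and> unsat_hitting F \<and> deficiency F = int k" for k F
  proof -
    have "enat (nvars F) \<le> ?S k" using F by (intro SUP_upper) simp
    also have "\<dots> \<le> N k" using I_le_N k by simp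
    finally show ?thesis using eq k by simp
  qed
  moreover have "N k = enat (4 * k - 5)"
    if b: "\<forall>k\<ge>3. \<forall>F. clause_irreducible F \<and> unsat_hitting F \<and> deficiency F = int k \<longrightarrow> nvars F \<le> 4 * k - 5"
      and k: "k \<ge> 2" for k
  proof (rule antisym)
    \<comment> \<open>With \<open>m\<close> constantly 4 and \<open>j = k - 1\<close>, the bound
      \<open>j * 4 - 1\<close> is exactly \<open>4 * k - 5\<close>.\<close>
    have "nvars F < j * 4"
      if "clause_irreducible F" "unsat_hitting F" "deficiency F = int j + 1" "2 \<le> j" for F j
    proof -
      have "nvars F \<le> 4 * Suc j - 5" using that by (intro b[rule_format]) auto
      then show ?thesis using that(4) by simp
    qed
    then have "N (Suc (k - 1)) \<le> enat ((k - 1) * 4 - 1)" by (intro N_bound[of "\<lambda>_. 4"]) (auto simp: mono_def)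
    then show "N k \<le> enat (4 * k - 5)" using k by (simp add: diff_mult_distrib mult.commute)
    show "enat (4 * k - 5) \<le> N k" using N_ge[OF k] .
  qed
  ultimately show ?thesis by blast
qed

end
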